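(* Let $P\in\overline{\mathbb{Q}}[Z,W]$ be nonzero, $P=\sum_{\alpha\in S}c_\alpha Z^{a_\alpha}W^{b_\alpha}$, where $S=\operatorname{supp}P\subset\mathbb{N}^2$, $\alpha=(a_\alpha,b_\alpha)$ and $c_\alpha\neq0$ for all $\alpha\in S$. Let $c,d\in\mathbb{Z}$ with $c+d>0$, and let $\ell(a,b)=ca+db$. Put $\lambda=\min_{\alpha\in S}\ell(\alpha)$, $F=\{\alpha\in S:\ell(\alpha)=\lambda\}$, and $$R(z)=\sum_{\alpha\in F}c_\alpha z^{a_\alpha-b_\alpha}\in\overline{\mathbb{Q}}[z,z^{-1}].$$ Suppose $\mathbb{E}(P^m)=0$ for every integer $m\ge1$ and $\lambda/(c+d)\ge0$. Let $B\ge1$ be the denominator of $\lambda/(c+d)$ in lowest terms. Then $$\mathrm{CT}\,R(z)^{Bn}=0\qquad\text{for every integer } n\ge1.$$ Consequently every exponent occurring in $R$ is strictly positive, or every exponent occurring in $R$ is strictly negative; equivalently, the weights $a_\alpha-b_\alpha$ for $\alpha\in F$ are all strictly positive or all strictly negative.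
   Context: $X,Y$ are independent standard real Gaussian random variables, $Z=(X+iY)/\sqrt2$, $W=(X-iY)/\sqrt2$, and $\mathbb{E}(P)$ is the expectation of the polynomial $P$ evaluated at these random variables. $\overline{\mathbb{Q}}\subset\mathbb{C}$ is the field of algebraic numbers, and $\mathbb{N}$ includes $0$. The support $\operatorname{supp}P$ is the set of exponent pairs $(a,b)$ such that $Z^aW^b$ has nonzero coefficient in $P$. The weight of $Z^aW^b$ (or of the exponent pair $(a,b)$) is $a-b$. $\mathrm{CT}\,g$ denotes the constant term (coefficient of $z^0$) of a Laurent polynomial $g(z)$. An exponent occurs in $R$ if the corresponding power of $z$ has nonzero coefficient in $R$. *)

theory Defs
  imports
    "HOL-Probability.Probability"
    "HOL-Computational_Algebra.Computational_Algebra"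
    "HOL-Library.Poly_Mapping"
    "HOL-Library.Product_Plus"
begin

text \<open>
  A polynomial in two variables \<open>Z, W\<close> is a finitely supported function on exponent
  pairs, a Laurent polynomial in \<open>z\<close> a finitely supported function on integer exponents;
  products and powers are the convolution products of \<^theory>\<open>HOL-Library.Poly_Mapping\<close>.
  In both cases the support is given by \<^const>\<open>Poly_Mapping.keys\<close>, the coefficients by \<^const>\<open>Poly_Mapping.lookup\<close>.
\<close>

type_synonym poly_ZW = "(nat \<times> nat) \<Rightarrow>\<^sub>0 complex"
type_synonym laurent_poly = "int \<Rightarrow>\<^sub>0 complex"

definition eval_ZW :: "poly_ZW \<Rightarrow> complex \<Rightarrow> complex \<Rightarrow> complex" where
  "eval_ZW P z w = (\<Sum>(a, b)\<in>Poly_Mapping.keys P. Poly_Mapping.lookup P (a, b) * z ^ a * w ^ b)"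

definition gauss_expectation ::
    "'a measure \<Rightarrow> ('a \<Rightarrow> real) \<Rightarrow> ('a \<Rightarrow> real) \<Rightarrow> poly_ZW \<Rightarrow> complex" where
  "gauss_expectation M X Y P =
     (LINT \<omega>|M. eval_ZW P ((complex_of_real (X \<omega>) + \<i> * complex_of_real (Y \<omega>)) / complex_of_real (sqrt 2))
                         ((complex_of_real (X \<omega>) - \<i> * complex_of_real (Y \<omega>)) / complex_of_real (sqrt 2)))"

definition weight :: "nat \<times> nat \<Rightarrow> int" where
  "weight \<alpha> = int (fst \<alpha>) - int (snd \<alpha>)"

definition CT :: "laurent_poly \<Rightarrow> complex" where
  "CT g = Poly_Mapping.lookup g 0"

end

theory Submission
  imports Defs "Jordan_Normal_Form.Char_Poly" "HOL-Library.Real_Mod"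
begin

text \<open>
  The Gaussian expectation of \<open>Z ^ a * W ^ b\<close> is \<open>fact a\<close> if \<open>a = b\<close> and \<open>0\<close> otherwise. So the
  hypothesis says that for every power of \<open>P\<close> the diagonal coefficients, weighted by factorials,
  sum to zero. The linear form \<open>l\<close> is \<open>(c + d) * k\<close> at \<open>(k, k)\<close> and at least \<open>m * lam\<close> on the support
  of \<open>P ^ m\<close>. If \<open>m\<close> is a multiple of \<open>B\<close>, the lowest possible diagonal index \<open>k1 = m * lam / (c + d)\<close>
  is a natural number, and the coefficient of \<open>P ^ m\<close> at \<open>(k1, k1)\<close> comes from the face \<open>F\<close> alone: it is
  the constant term of \<open>R ^ m\<close>.

  That this lowest coefficient \<open>\<gamma>\<close> vanishes is seen by reduction modulo primes. After clearing
  denominators all coefficients are algebraic integers. For a prime \<open>p\<close>, the \<open>p\<close>-th power of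
  \<open>P ^ m\<close> has, modulo \<open>p\<close>, only exponents divisible by \<open>p\<close>, and its lowest diagonal coefficient is
  \<open>\<gamma> ^ p\<close>. In the weighted sum the quotients of factorials kill all later terms modulo \<open>p\<close>, so
  \<open>\<gamma> ^ p\<close> is divisible by \<open>p\<close> for every prime \<open>p\<close>, which forces \<open>\<gamma> = 0\<close>
  (lemma \<open>lowest_diagonal_coeff_eq_0\<close>).

  The second part is the theorem of Duistermaat and van der Kallen for one variable and algebraic
  coefficients (lemma \<open>constant_terms_zero_imp_one_sided\<close>), applied to \<open>R ^ B\<close>. Suppose that
  \<open>f\<close> is a Laurent polynomial with exponents of both signs, and that all its positive powers have
  constant term zero. For large \<open>w\<close> the logarithm of \<open>1 - f / w\<close> on the unit circle then has mean zero, so by Jensen's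
  formula the absolute value of the product of the solutions of \<open>f z = w\<close> inside the unit circle
  is a constant divided by \<open>w\<close>. But when \<open>w\<close> is a natural number, this product is, up to a fixed
  factor, an algebraic integer. After multiplication with the complex conjugate, arbitrarily large
  natural numbers \<open>w\<close> would divide a fixed nonzero algebraic integer. To keep the analysis elementary, circle means are replaced by means
  over roots of unity.

  Both parts use that the algebraic integers form an integrally closed ring.
\<close>

section \<open>The ring of algebraic integers\<close>

definition int_span :: "'a::comm_ring_1 set \<Rightarrow> 'a set" where
  "int_span G = range (\<lambda>c. \<Sum>g\<in>G. of_int (c g) * g)"

text \<open>
  The ring of multipliers of the lattice spanned by \<open>G\<close>. When \<open>G\<close> is finite and contains
  \<open>1\<close>, all of its elements are integral, and conversely finitely many integral elements are
  multipliers of a common finite \<open>G\<close>. So sums, products and roots can be formed inside one ring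
  instead of by manipulating minimal polynomials.
\<close>

definition multipliers :: "'a::comm_ring_1 set \<Rightarrow> 'a set" where
  "multipliers G = {a. \<forall>g\<in>G. a * g \<in> int_span G}"

lemma int_spanI: "x = (\<Sum>g\<in>G. of_int (c g) * g) \<Longrightarrow> x \<in> int_span G"
  unfolding int_span_def by blast

lemma int_span_0: "0 \<in> int_span G"
  by (rule int_spanI[where c = "\<lambda>_. 0"]) simp

lemma int_span_add:
  assumes "x \<in> int_span G" "y \<in> int_span G"
  shows "x + y \<in> int_span G"
proof -
  obtain c d where "x = (\<Sum>g\<in>G. of_int (c g) * g)" "y = (\<Sum>g\<in>G. of_int (d g) * g)"
    using assms unfolding int_span_def by blast
  then show ?thesis
    by (intro int_spanI[where c = "\<lambda>g. c g + d g"]) (simp add: sum.distrib algebra_simps)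
qed

lemma int_span_of_int_mult:
  assumes "x \<in> int_span G"
  shows "of_int k * x \<in> int_span G"
proof -
  obtain c where "x = (\<Sum>g\<in>G. of_int (c g) * g)"
    using assms unfolding int_span_def by blast
  then show ?thesis
    by (intro int_spanI[where c = "\<lambda>g. k * c g"]) (simp add: sum_distrib_left mult.assoc)
qed

lemma int_span_sum: "(\<And>i. i \<in> I \<Longrightarrow> f i \<in> int_span G) \<Longrightarrow> sum f I \<in> int_span G"
  by (induction I rule: infinite_finite_induct) (auto intro: int_span_0 int_span_add)

lemma int_span_base:
  assumes "finite G" "g \<in> G"
  shows "g \<in> int_span G"
proof (rule int_spanI[where c = "\<lambda>h. if h = g then 1 else 0"])
  have "(\<Sum>h\<in>G. of_int (if h = g then 1 else 0) * h) = (\<Sum>h\<in>G. if h = g then h else 0)"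
    by (intro sum.cong) auto
  then show "g = (\<Sum>h\<in>G. of_int (if h = g then 1 else 0) * h)"
    using assms by simp
qed

lemma multipliers_mult_int_span:
  assumes "a \<in> multipliers G" "x \<in> int_span G"
  shows "a * x \<in> int_span G"
proof -
  obtain c where x: "x = (\<Sum>g\<in>G. of_int (c g) * g)"
    using assms unfolding int_span_def by blast
  have "a * x = (\<Sum>g\<in>G. of_int (c g) * (a * g))"
    unfolding x by (simp add: sum_distrib_left mult.left_commute)
  also have "\<dots> \<in> int_span G"
    using assms(1) by (intro int_span_sum int_span_of_int_mult) (auto simp: multipliers_def)
  finally show ?thesis .
qed

lemma multipliers_add: "a \<in> multipliers G \<Longrightarrow> b \<in> multipliers G \<Longrightarrow> a + b \<in> multipliers G"
  unfolding multipliers_def by (auto simp: ring_distribs intro: int_span_add)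

lemma multipliers_mult: "a \<in> multipliers G \<Longrightarrow> b \<in> multipliers G \<Longrightarrow> a * b \<in> multipliers G"
  using multipliers_mult_int_span[of a G] by (auto simp: multipliers_def mult.assoc)

lemma multipliers_of_int: "finite G \<Longrightarrow> of_int k \<in> multipliers G"
  unfolding multipliers_def by (auto intro: int_span_of_int_mult int_span_base)

text \<open>
  The determinant trick: multiplication by \<open>a\<close> on the generators is an integer matrix \<open>A\<close>, and the
  vector of generators, nonzero because it has \<open>1\<close> as an entry, is an eigenvector of \<open>A\<close> with
  eigenvalue \<open>a\<close>. So \<open>a\<close> is a root of the characteristic polynomial, which is monic over the
  integers.
\<close>

lemma multiplier_imp_algebraic_int:
  fixes a :: "'a::field_char_0"
  assumes "finite G" "1 \<in> G" "a \<in> multipliers G"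
  shows "algebraic_int a"
proof -
  obtain f where f: "bij_betw f {..<card G} G"
    using finite_same_card_bij[of "{..<card G}" G] assms(1) by auto
  define n where "n = card G"
  have "\<forall>g\<in>G. \<exists>c. a * g = (\<Sum>h\<in>G. of_int (c h) * h)"
    using assms(3) unfolding multipliers_def int_span_def by blast
  then obtain c where c: "\<And>g. g \<in> G \<Longrightarrow> a * g = (\<Sum>h\<in>G. of_int (c g h) * h)"
    by metis
  define A :: "int mat" where "A = mat n n (\<lambda>(i, j). c (f i) (f j))"
  define A' :: "'a mat" where "A' = map_mat of_int A"
  define v where "v = vec n f"
  have A: "A \<in> carrier_mat n n" and A': "A' \<in> carrier_mat n n"
    by (simp_all add: A_def A'_def)
  have "A' *\<^sub>v v = a \<cdot>\<^sub>v v"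
  proof
    fix i assume "i < dim_vec (a \<cdot>\<^sub>v v)"
    then have i: "i < n" by (simp add: v_def)
    then have "f i \<in> G" using f by (auto simp: n_def bij_betw_def)
    then have "a * f i = (\<Sum>h\<in>G. of_int (c (f i) h) * h)" by (rule c)
    also have "\<dots> = (\<Sum>j<n. of_int (c (f i) (f j)) * f j)"
      using sum.reindex_bij_betw[OF f, of "\<lambda>h. of_int (c (f i) h) * h"] by (simp add: n_def)
    finally show "(A' *\<^sub>v v) $ i = (a \<cdot>\<^sub>v v) $ i"
      using i by (simp add: A'_def A_def v_def scalar_prod_def atLeast0LessThan)
  qed (simp add: A'_def A_def v_def)
  moreover have "v \<noteq> 0\<^sub>v n"
  proof
    assume v0: "v = 0\<^sub>v n"
    obtain i where "i < n" "f i = 1"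
      using f assms(2) unfolding bij_betw_def n_def by (metis imageE lessThan_iff)
    then have "v $ i = 1" by (simp add: v_def)
    with v0 \<open>i < n\<close> show False by simp
  qed
  ultimately have "eigenvalue A' a"
    using A' unfolding eigenvalue_def eigenvector_def
    by (intro exI[of _ v]) (auto simp: v_def)
  then have "poly (char_poly A') a = 0"
    using eigenvalue_root_char_poly[OF A'] by blast
  moreover have "char_poly A' = map_poly of_int (char_poly A)"
    unfolding A'_def by (rule of_int_hom.char_poly_hom[OF A])
  moreover have "lead_coeff (char_poly A') = 1"
    using degree_monic_char_poly[OF A'] by simp
  ultimately show ?thesis
    by (intro algebraic_int.intros[of "char_poly A'"]) (auto simp: coeff_map_poly)
qed

text \<open>
  The lattice spanned by the \<open>g * x ^ j\<close> with \<open>j\<close> below the degree of \<open>p\<close> is closed under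
  multiplication by \<open>x\<close>, because the equation \<open>poly p x = 0\<close> reduces the first power that falls
  outside.
\<close>

lemma multipliers_adjoin_root:
  fixes x :: "'a::comm_ring_1"
  assumes G: "finite G" "1 \<in> G"
    and p: "lead_coeff p = 1" "\<And>i. coeff p i \<in> multipliers G" "poly p x = 0"
  obtains H where "finite H" "1 \<in> H" "multipliers G \<subseteq> multipliers H" "x \<in> multipliers H"
proof -
  define n where "n = degree p"
  define H where "H = (\<lambda>(g, j). g * x ^ j) ` (G \<times> {..<n})"
  have "n \<noteq> 0"
  proof
    assume "n = 0"
    then obtain c where "p = [:c:]" unfolding n_def using degree_eq_zeroE by blast
    with p(1,3) show False by simp
  qed
  have fin: "finite H" using G by (simp add: H_def)
  have one: "1 \<in> H" using G \<open>n \<noteq> 0\<close> unfolding H_def by force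
  have span: "y * x ^ j \<in> int_span H" if "y \<in> int_span G" "j < n" for y j
  proof -
    obtain c where y: "y = (\<Sum>g\<in>G. of_int (c g) * g)"
      using \<open>y \<in> int_span G\<close> unfolding int_span_def by blast
    have "y * x ^ j = (\<Sum>g\<in>G. of_int (c g) * (g * x ^ j))"
      by (simp add: y sum_distrib_right mult.assoc)
    also have "\<dots> \<in> int_span H"
      using \<open>j < n\<close> fin by (intro int_span_sum int_span_of_int_mult int_span_base) (auto simp: H_def)
    finally show ?thesis .
  qed
  have "multipliers G \<subseteq> multipliers H"
  proof
    fix a assume a: "a \<in> multipliers G"
    show "a \<in> multipliers H"
      unfolding multipliers_def
    proof (intro CollectI ballI)
      fix h assume "h \<in> H"
      then obtain g j where h: "g \<in> G" "j < n" "h = g * x ^ j" by (auto simp: H_def)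
      then have "(a * g) * x ^ j \<in> int_span H"
        using a by (intro span) (auto simp: multipliers_def)
      then show "a * h \<in> int_span H" by (simp add: h mult.assoc)
    qed
  qed
  moreover have "x \<in> multipliers H"
    unfolding multipliers_def
  proof (intro CollectI ballI)
    fix h assume "h \<in> H"
    then obtain g j where h: "g \<in> G" "j < n" "h = g * x ^ j" by (auto simp: H_def)
    show "x * h \<in> int_span H"
    proof (cases "Suc j < n")
      case True
      then have "g * x ^ Suc j \<in> int_span H"
        using h G by (intro span int_span_base)
      then show ?thesis by (simp add: h mult_ac)
    next
      case False
      then have j: "n = Suc j" using h by simp
      have "(\<Sum>i\<le>n. coeff p i * x ^ i) = 0"
        using p(3) by (simp add: poly_altdef n_def)
      then have "(\<Sum>i<n. coeff p i * x ^ i) + x ^ n = 0"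
        using p(1) by (simp add: n_def lessThan_Suc_atMost[symmetric])
      then have "x ^ n = - (\<Sum>i<n. coeff p i * x ^ i)"
        by (simp add: eq_neg_iff_add_eq_0 add.commute)
      have "x * h = g * x ^ n" using j by (simp add: h mult_ac)
      also have "\<dots> = of_int (-1) * (g * (\<Sum>i<n. coeff p i * x ^ i))"
        unfolding \<open>x ^ n = _\<close> by simp
      also have "g * (\<Sum>i<n. coeff p i * x ^ i) = (\<Sum>i<n. (coeff p i * g) * x ^ i)"
        unfolding sum_distrib_left by (intro sum.cong) (simp_all add: mult_ac)
      also have "of_int (-1) * \<dots> \<in> int_span H"
        using p(2) h by (intro int_span_of_int_mult int_span_sum span) (auto simp: multipliers_def)
      finally show ?thesis .
    qed
  qed
  ultimately show ?thesis using that fin one by blast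
qed

lemma algebraic_ints_have_common_module:
  fixes A :: "'a::field set"
  assumes "finite A" "\<And>a. a \<in> A \<Longrightarrow> algebraic_int a"
  obtains G where "finite G" "1 \<in> G" "A \<subseteq> multipliers G"
proof -
  have "\<exists>G. finite G \<and> 1 \<in> G \<and> A \<subseteq> multipliers G"
    using assms
  proof (induction A rule: finite_induct)
    case empty
    show ?case by (intro exI[of _ "{1}"]) auto
  next
    case (insert a A)
    then obtain G where G: "finite G" "1 \<in> G" "A \<subseteq> multipliers G" by blast
    obtain p where p: "lead_coeff p = 1" "\<forall>i. coeff p i \<in> \<int>" "poly p a = 0"
      using insert.prems[of a] by (auto elim: algebraic_int.cases)
    have "coeff p i \<in> multipliers G" for i
      using p(2) multipliers_of_int[OF G(1)] by (metis Ints_cases)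
    from multipliers_adjoin_root[OF G(1,2) p(1) this p(3)]
    show ?case using G(3) by (metis insert_subset subset_trans)
  qed
  then show ?thesis using that by blast
qed

lemma algebraic_int_add:
  fixes a b :: "'a::field_char_0"
  assumes "algebraic_int a" "algebraic_int b"
  shows "algebraic_int (a + b)"
proof -
  obtain G where "finite G" "1 \<in> G" "{a, b} \<subseteq> multipliers G"
    using algebraic_ints_have_common_module[of "{a, b}"] assms by auto
  then show ?thesis
    by (intro multiplier_imp_algebraic_int multipliers_add) auto
qed

lemma algebraic_int_mult:
  fixes a b :: "'a::field_char_0"
  assumes "algebraic_int a" "algebraic_int b"
  shows "algebraic_int (a * b)"
proof -
  obtain G where "finite G" "1 \<in> G" "{a, b} \<subseteq> multipliers G"
    using algebraic_ints_have_common_module[of "{a, b}"] assms by auto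
  then show ?thesis
    by (intro multiplier_imp_algebraic_int multipliers_mult) auto
qed

lemma algebraic_int_monic_root:
  fixes x :: "'a::field_char_0"
  assumes "lead_coeff p = 1" "\<And>i. algebraic_int (coeff p i)" "poly p x = 0"
  shows "algebraic_int x"
proof -
  obtain G where G: "finite G" "1 \<in> G" "coeff p ` {..degree p} \<subseteq> multipliers G"
    using algebraic_ints_have_common_module[of "coeff p ` {..degree p}"] assms(2) by auto
  have "coeff p i \<in> multipliers G" for i
  proof (cases "i \<le> degree p")
    case False
    then show ?thesis
      using multipliers_of_int[OF G(1), of 0] by (simp add: coeff_eq_0)
  qed (use G(3) in auto)
  from multipliers_adjoin_root[OF G(1,2) assms(1) this assms(3)] multiplier_imp_algebraic_int
  show ?thesis by metis
qed

lemma algebraic_int_of_nat: "algebraic_int (of_nat k)"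
  by (rule int_imp_algebraic_int) simp

lemma algebraic_int_power: "algebraic_int (a :: 'a::field_char_0) \<Longrightarrow> algebraic_int (a ^ n)"
  by (induction n) (auto intro: algebraic_int_mult int_imp_algebraic_int)

lemma algebraic_int_diff: "algebraic_int (a :: 'a::field_char_0) \<Longrightarrow> algebraic_int b \<Longrightarrow> algebraic_int (a - b)"
  using algebraic_int_add[of a "- b"] by auto

lemma algebraic_int_sum:
  "(\<And>i. i \<in> I \<Longrightarrow> algebraic_int (f i :: 'a::field_char_0)) \<Longrightarrow> algebraic_int (sum f I)"
  by (induction I rule: infinite_finite_induct) (auto intro: algebraic_int_add)

lemma algebraic_int_prod_mset:
  "(\<And>x. x \<in># A \<Longrightarrow> algebraic_int (x :: 'a::field_char_0)) \<Longrightarrow> algebraic_int (prod_mset A)"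
  by (induction A) (auto intro: algebraic_int_mult int_imp_algebraic_int)

text \<open>
  Multiplying \<open>p\<close> by the power \<open>n - 1\<close> of its leading coefficient \<open>a\<close>, where \<open>n\<close> is the degree,
  turns it into a polynomial in \<open>a * x\<close> that is monic and still has integral coefficients.
\<close>

lemma algebraic_int_lead_coeff_mult_root:
  fixes x :: "'a::field_char_0"
  assumes int: "\<And>i. algebraic_int (coeff p i)" and root: "poly p x = 0" and deg: "degree p > 0"
  shows "algebraic_int (lead_coeff p * x)"
proof -
  define n where "n = degree p"
  define a where "a = lead_coeff p"
  have "a \<noteq> 0" using deg unfolding a_def by auto
  define q where "q = monom 1 n + (\<Sum>i<n. monom (coeff p i * a ^ (n - 1 - i)) i)"
  have cq: "coeff q i = (if i = n then 1 else if i < n then coeff p i * a ^ (n - 1 - i) else 0)" for i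
    by (auto simp: q_def coeff_sum)
  have "degree q = n"
    by (intro antisym degree_le le_degree) (auto simp: cq)
  then have lc: "lead_coeff q = 1" by (simp add: cq)
  have "poly q (a * x) = a ^ n * x ^ n + (\<Sum>i<n. coeff p i * a ^ (n - 1 - i) * (a * x) ^ i)"
    by (simp add: q_def poly_monom poly_sum power_mult_distrib)
  also have "(\<Sum>i<n. coeff p i * a ^ (n - 1 - i) * (a * x) ^ i) = a ^ (n - 1) * (\<Sum>i<n. coeff p i * x ^ i)"
    unfolding sum_distrib_left
  proof (rule sum.cong)
    fix i assume "i \<in> {..<n}"
    then have "n - 1 = (n - 1 - i) + i" by simp
    then have "a ^ (n - 1) = a ^ (n - 1 - i) * a ^ i" by (metis power_add)
    then show "coeff p i * a ^ (n - 1 - i) * (a * x) ^ i = a ^ (n - 1) * (coeff p i * x ^ i)"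
      by (simp add: power_mult_distrib mult_ac)
  qed simp
  also have "a ^ n = a ^ (n - 1) * a"
    using deg unfolding n_def by (metis power_Suc2 Suc_diff_1)
  also have "a ^ (n - 1) * a * x ^ n + a ^ (n - 1) * (\<Sum>i<n. coeff p i * x ^ i) = a ^ (n - 1) * poly p x"
    by (simp add: poly_altdef lessThan_Suc_atMost[symmetric] a_def n_def algebra_simps)
  finally have "poly q (a * x) = 0" using root by simp
  moreover have "algebraic_int (coeff q i)" for i
    using algebraic_int_mult[OF int algebraic_int_power[OF int]] by (simp add: cq a_def)
  ultimately show ?thesis
    using algebraic_int_monic_root[of q "a * x"] lc unfolding a_def by blast
qed

lemma algebraic_has_integral_multiple:
  fixes x :: "'a::field_char_0"
  assumes "algebraic x"
  obtains D :: nat where "D > 0" "algebraic_int (of_nat D * x)"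
proof (cases "x = 0")
  case True
  then show ?thesis using that[of 1] by simp
next
  case False
  obtain p where p: "\<And>i. coeff p i \<in> \<int>" "p \<noteq> 0" "poly p x = 0"
    using assms unfolding algebraic_def by blast
  have deg: "degree p > 0"
    using p(2,3) by (metis degree_eq_zeroE gr0I mult_zero_right pCons_eq_0_iff poly_0 poly_pCons add.right_neutral)
  have "algebraic_int (lead_coeff p * x)"
    using p deg by (intro algebraic_int_lead_coeff_mult_root) (auto intro: int_imp_algebraic_int)
  moreover obtain k :: int where k: "lead_coeff p = of_int k"
    using p(1) by (metis Ints_cases)
  moreover have "k \<noteq> 0" using k p(2) by auto
  ultimately have "algebraic_int (of_nat (nat \<bar>k\<bar>) * x)"
    by (cases "k \<ge> 0") (auto simp: algebraic_int_minus_iff[of "of_int k * x", symmetric] simp del: algebraic_int_minus_iff)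
  with that[of "nat \<bar>k\<bar>"] \<open>k \<noteq> 0\<close> show ?thesis by simp
qed

lemma algebraic_finite_common_denominator:
  fixes A :: "'a::field_char_0 set"
  assumes "finite A" "\<And>x. x \<in> A \<Longrightarrow> algebraic x"
  obtains D :: nat where "D > 0" "\<And>x. x \<in> A \<Longrightarrow> algebraic_int (of_nat D * x)"
proof -
  have "\<exists>D::nat. D > 0 \<and> (\<forall>x\<in>A. algebraic_int (of_nat D * x))"
    using assms
  proof (induction A rule: finite_induct)
    case empty
    show ?case by auto
  next
    case (insert a A)
    then obtain D :: nat where D: "D > 0" "\<forall>x\<in>A. algebraic_int (of_nat D * x)" by auto
    obtain E :: nat where E: "E > 0" "algebraic_int (of_nat E * a)"
      using insert.prems algebraic_has_integral_multiple by blast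
    have "algebraic_int (of_nat (D * E) * x)" if "x \<in> insert a A" for x
    proof (cases "x = a")
      case True
      with algebraic_int_mult[OF algebraic_int_of_nat[of D] E(2)] show ?thesis by (simp add: mult_ac)
    next
      case False
      with that D have "algebraic_int (of_nat D * x)" by blast
      from algebraic_int_mult[OF algebraic_int_of_nat[of E] this] show ?thesis by (simp add: mult_ac)
    qed
    with D(1) E(1) show ?case by (intro exI[of _ "D * E"]) auto
  qed
  then show ?thesis using that by blast
qed

text \<open>
  This replaces norms: a nonzero algebraic integer that is divisible by many rational integers
  passes these divisors on to the nonzero rational integer \<open>N\<close>.
\<close>

lemma algebraic_int_divides_integer:
  fixes x :: "'a::field_char_0"
  assumes "algebraic_int x" "x \<noteq> 0"
  obtains N :: int where "N \<noteq> 0" "algebraic_int (of_int N / x)"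
proof -
  have "algebraic (inverse x)" using assms by auto
  then obtain D :: nat where "D > 0" "algebraic_int (of_nat D * inverse x)"
    using algebraic_has_integral_multiple by blast
  with that[of "int D"] show ?thesis by (simp add: field_simps)
qed

lemma algebraic_int_quotient_imp_dvd:
  assumes "m \<noteq> 0" "algebraic_int (of_int k / of_int m :: 'a::field_char_0)"
  shows "m dvd k"
proof -
  have "(of_int k / of_int m :: 'a) \<in> \<int>"
    using assms(2) by (rule rational_algebraic_int_is_int) auto
  then obtain j where "(of_int k / of_int m :: 'a) = of_int j" by (auto elim: Ints_cases)
  then have "(of_int k :: 'a) = of_int (m * j)" using assms(1) by (simp add: field_simps)
  then show ?thesis by (simp only: of_int_eq_iff) simp
qed

section \<open>Powers of polynomials and divisibility by primes\<close>

lemma poly_mapping_eq_sum_single: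
  "f = (\<Sum>k\<in>Poly_Mapping.keys f. Poly_Mapping.single k (Poly_Mapping.lookup f k))"
proof (rule poly_mapping_eqI)
  fix k
  show "Poly_Mapping.lookup f k =
    Poly_Mapping.lookup (\<Sum>k\<in>Poly_Mapping.keys f. Poly_Mapping.single k (Poly_Mapping.lookup f k)) k"
    by (cases "k \<in> Poly_Mapping.keys f")
       (auto simp: lookup_sum lookup_single when_def in_keys_iff)
qed

lemma poly_mapping_mult_eq_sum_single:
  fixes f g :: "'k::comm_monoid_add \<Rightarrow>\<^sub>0 'c::comm_semiring_1"
  shows "f * g = (\<Sum>k\<in>Poly_Mapping.keys f. \<Sum>l\<in>Poly_Mapping.keys g.
    Poly_Mapping.single (k + l) (Poly_Mapping.lookup f k * Poly_Mapping.lookup g l))"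
  by (subst (1 2) poly_mapping_eq_sum_single) (simp add: sum_product mult_single)

lemma lookup_const_mult:
  fixes f :: "'k::comm_monoid_add \<Rightarrow>\<^sub>0 'c::comm_semiring_1"
  shows "Poly_Mapping.lookup (Poly_Mapping.single 0 c * f) k = c * Poly_Mapping.lookup f k"
  by (simp add: Poly_Mapping.map.rep_eq when_def flip: mult_map_scale_conv_mult)

text \<open>
  Substituting \<open>\<phi> k\<close> for the monomial with exponent \<open>k\<close> and applying \<open>\<iota>\<close> to the coefficients.
  Below it is used to collapse a polynomial in two variables to a Laurent polynomial along the
  weight, and to view a Laurent polynomial as a formal Laurent series.
\<close>

definition monomial_subst ::
    "('c \<Rightarrow> 'r) \<Rightarrow> ('k \<Rightarrow> 'r) \<Rightarrow> ('k \<Rightarrow>\<^sub>0 'c::zero) \<Rightarrow> 'r::comm_semiring_1" where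
  "monomial_subst \<iota> \<phi> f = (\<Sum>k\<in>Poly_Mapping.keys f. \<iota> (Poly_Mapping.lookup f k) * \<phi> k)"

locale monomial_substitution =
  fixes \<iota> :: "'c::comm_semiring_1 \<Rightarrow> 'r::comm_semiring_1" and \<phi> :: "'k::comm_monoid_add \<Rightarrow> 'r"
  assumes \<iota>_0: "\<iota> 0 = 0" and \<iota>_1: "\<iota> 1 = 1"
    and \<iota>_add: "\<iota> (a + b) = \<iota> a + \<iota> b" and \<iota>_mult: "\<iota> (a * b) = \<iota> a * \<iota> b"
    and \<phi>_0: "\<phi> 0 = 1" and \<phi>_add: "\<phi> (k + l) = \<phi> k * \<phi> l"
begin

lemma subst_single: "monomial_subst \<iota> \<phi> (Poly_Mapping.single k c) = \<iota> c * \<phi> k"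
  by (simp add: monomial_subst_def \<iota>_0)

lemma subst_add: "monomial_subst \<iota> \<phi> (f + g) = monomial_subst \<iota> \<phi> f + monomial_subst \<iota> \<phi> g"
  unfolding monomial_subst_def
  using setsum_keys_plus_distrib[of "\<lambda>k c. \<iota> c * \<phi> k" f g]
  by (simp add: \<iota>_0 \<iota>_add distrib_right)

lemma subst_sum: "monomial_subst \<iota> \<phi> (sum F A) = (\<Sum>a\<in>A. monomial_subst \<iota> \<phi> (F a))"
  by (induction A rule: infinite_finite_induct) (simp_all add: subst_add, simp_all add: monomial_subst_def)

lemma subst_mult: "monomial_subst \<iota> \<phi> (f * g) = monomial_subst \<iota> \<phi> f * monomial_subst \<iota> \<phi> g"
proof -
  have "monomial_subst \<iota> \<phi> (f * g) = (\<Sum>k\<in>Poly_Mapping.keys f. \<Sum>l\<in>Poly_Mapping.keys g.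
      \<iota> (Poly_Mapping.lookup f k) * \<phi> k * (\<iota> (Poly_Mapping.lookup g l) * \<phi> l))"
    unfolding poly_mapping_mult_eq_sum_single
    by (simp add: subst_sum subst_single \<iota>_mult \<phi>_add mult_ac)
  then show ?thesis by (simp add: monomial_subst_def sum_product)
qed

lemma subst_power: "monomial_subst \<iota> \<phi> (f ^ n) = monomial_subst \<iota> \<phi> f ^ n"
proof (induction n)
  case 0
  show ?case using subst_single[of 0 1] by (simp add: \<iota>_1 \<phi>_0)
qed (simp add: subst_mult)

end

text \<open>
  If \<open>Q\<close> is the part of \<open>P\<close> on which the additive function \<open>l\<close> takes its minimal value \<open>lam\<close>, then
  \<open>Q ^ m\<close> is the part of \<open>P ^ m\<close> on which \<open>l\<close> takes its minimal value \<open>m * lam\<close>: the difference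
  \<open>P ^ m - Q ^ m\<close> is a sum of products that each contain a factor above the face.
\<close>

lemma face_power:
  fixes P Q :: "'k::comm_monoid_add \<Rightarrow>\<^sub>0 'c::comm_ring_1" and l :: "'k \<Rightarrow> int"
  assumes l0: "l 0 = 0" and ladd: "\<And>a b. l (a + b) = l a + l b"
    and Q: "\<And>k. k \<in> Poly_Mapping.keys Q \<Longrightarrow> l k = lam"
    and PQ: "\<And>k. k \<in> Poly_Mapping.keys (P - Q) \<Longrightarrow> l k > lam"
  shows "(\<forall>k\<in>Poly_Mapping.keys (Q ^ m). l k = int m * lam) \<and>
         (\<forall>k\<in>Poly_Mapping.keys (P ^ m - Q ^ m). l k > int m * lam)"
proof (induction m)
  case 0
  show ?case by (simp add: l0)
next
  case (Suc m)
  have Qm: "l k = int (Suc m) * lam" if k: "k \<in> Poly_Mapping.keys (Q ^ Suc m)" for k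
  proof -
    obtain a b where "k = a + b" "a \<in> Poly_Mapping.keys Q" "b \<in> Poly_Mapping.keys (Q ^ m)"
      using k keys_mult[of Q "Q ^ m"] unfolding power_Suc by blast
    then show ?thesis using Q Suc by (simp add: ladd algebra_simps)
  qed
  have P: "l k \<ge> lam" if "k \<in> Poly_Mapping.keys P" for k
  proof -
    have "k \<in> Poly_Mapping.keys (P - Q) \<or> k \<in> Poly_Mapping.keys Q"
      using that keys_add[of "P - Q" Q] by (simp only: diff_add_cancel) blast
    then show ?thesis using Q PQ by (auto intro: less_imp_le)
  qed
  have eq: "P ^ Suc m - Q ^ Suc m = P * (P ^ m - Q ^ m) + (P - Q) * Q ^ m"
    by (simp add: algebra_simps)
  have "l k > int (Suc m) * lam" if "k \<in> Poly_Mapping.keys (P ^ Suc m - Q ^ Suc m)" for k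
  proof -
    have "k \<in> Poly_Mapping.keys (P * (P ^ m - Q ^ m)) \<or> k \<in> Poly_Mapping.keys ((P - Q) * Q ^ m)"
      using that keys_add[of "P * (P ^ m - Q ^ m)" "(P - Q) * Q ^ m"] unfolding eq by blast
    then show ?thesis
    proof
      assume "k \<in> Poly_Mapping.keys (P * (P ^ m - Q ^ m))"
      then obtain a b where "k = a + b" "a \<in> Poly_Mapping.keys P" "b \<in> Poly_Mapping.keys (P ^ m - Q ^ m)"
        using keys_mult[of P "P ^ m - Q ^ m"] by blast
      then show ?thesis using P[of a] Suc by (auto simp: ladd algebra_simps intro: add_le_less_mono)
    next
      assume "k \<in> Poly_Mapping.keys ((P - Q) * Q ^ m)"
      then obtain a b where "k = a + b" "a \<in> Poly_Mapping.keys (P - Q)" "b \<in> Poly_Mapping.keys (Q ^ m)"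
        using keys_mult[of "P - Q" "Q ^ m"] by blast
      then show ?thesis using PQ[of a] Suc by (auto simp: ladd algebra_simps)
    qed
  qed
  with Qm show ?case by blast
qed

definition integral_coeffs :: "('k \<Rightarrow>\<^sub>0 'c::field_char_0) \<Rightarrow> bool" where
  "integral_coeffs f \<longleftrightarrow> (\<forall>k. algebraic_int (Poly_Mapping.lookup f k))"

lemma integral_coeffs_add: "integral_coeffs f \<Longrightarrow> integral_coeffs g \<Longrightarrow> integral_coeffs (f + g)"
  by (simp add: integral_coeffs_def lookup_add algebraic_int_add)

lemma integral_coeffs_single: "algebraic_int c \<Longrightarrow> integral_coeffs (Poly_Mapping.single k c)"
  by (auto simp: integral_coeffs_def lookup_single when_def)

lemma integral_coeffs_sum: "(\<And>i. i \<in> I \<Longrightarrow> integral_coeffs (f i)) \<Longrightarrow> integral_coeffs (sum f I)"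
  by (auto simp: integral_coeffs_def lookup_sum intro!: algebraic_int_sum)

lemma integral_coeffs_mult:
  fixes f g :: "'k::comm_monoid_add \<Rightarrow>\<^sub>0 'c::field_char_0"
  shows "integral_coeffs f \<Longrightarrow> integral_coeffs g \<Longrightarrow> integral_coeffs (f * g)"
  unfolding poly_mapping_mult_eq_sum_single
  by (intro integral_coeffs_sum integral_coeffs_single algebraic_int_mult) (simp_all add: integral_coeffs_def)

lemma integral_coeffs_of_nat:
  "integral_coeffs (of_nat n :: 'k::comm_monoid_add \<Rightarrow>\<^sub>0 'c::field_char_0)"
  unfolding single_of_nat[symmetric] by (intro integral_coeffs_single algebraic_int_of_nat)

lemma integral_coeffs_power:
  fixes f :: "'k::comm_monoid_add \<Rightarrow>\<^sub>0 'c::field_char_0"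
  shows "integral_coeffs f \<Longrightarrow> integral_coeffs (f ^ n)"
proof (induction n)
  case 0
  show ?case using integral_coeffs_of_nat[of 1] by simp
qed (simp add: integral_coeffs_mult)

lemma freshman_dream_add:
  fixes f g :: "'k::comm_monoid_add \<Rightarrow>\<^sub>0 'c::field_char_0"
  assumes p: "prime p" and "integral_coeffs f" "integral_coeffs g"
  shows "\<exists>h. integral_coeffs h \<and> (f + g) ^ p = f ^ p + g ^ p + of_nat p * h"
proof -
  have p1: "p > 1" using p by (rule prime_gt_1_nat)
  define h where "h = (\<Sum>k\<in>{1..<p}. of_nat ((p choose k) div p) * f ^ k * g ^ (p - k))"
  have "integral_coeffs h"
    unfolding h_def using assms(2,3)
    by (intro integral_coeffs_sum integral_coeffs_mult integral_coeffs_of_nat integral_coeffs_power)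
  moreover have "(f + g) ^ p = f ^ p + g ^ p + of_nat p * h"
  proof -
    have split: "{..p} = insert 0 (insert p {1..<p})" using p1 by auto
    have "of_nat p * h = (\<Sum>k\<in>{1..<p}. of_nat (p choose k) * f ^ k * g ^ (p - k))"
      unfolding h_def sum_distrib_left
    proof (rule sum.cong)
      fix k assume "k \<in> {1..<p}"
      then have "p dvd (p choose k)" using p by (intro dvd_choose_prime) auto
      then have "(of_nat (p choose k) :: 'k \<Rightarrow>\<^sub>0 'c) = of_nat p * of_nat ((p choose k) div p)"
        by (metis dvd_mult_div_cancel of_nat_mult)
      then show "of_nat p * (of_nat ((p choose k) div p) * f ^ k * g ^ (p - k)) =
          of_nat (p choose k) * f ^ k * g ^ (p - k)"
        by (simp add: mult.assoc)
    qed simp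
    then show ?thesis
      using p1 by (simp add: binomial_ring split algebra_simps)
  qed
  ultimately show ?thesis by blast
qed

lemma freshman_dream_sum:
  fixes f :: "'i \<Rightarrow> 'k::comm_monoid_add \<Rightarrow>\<^sub>0 'c::field_char_0"
  assumes p: "prime p" and "finite I" "\<And>i. i \<in> I \<Longrightarrow> integral_coeffs (f i)"
  shows "\<exists>h. integral_coeffs h \<and> (\<Sum>i\<in>I. f i) ^ p = (\<Sum>i\<in>I. f i ^ p) + of_nat p * h"
  using assms(2,3)
proof (induction I rule: finite_induct)
  case empty
  show ?case
    using p by (intro exI[of _ 0]) (auto simp: integral_coeffs_def power_0_left prime_gt_0_nat)
next
  case (insert i I)
  then obtain h where h: "integral_coeffs h" "(\<Sum>i\<in>I. f i) ^ p = (\<Sum>i\<in>I. f i ^ p) + of_nat p * h" by auto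
  obtain h' where h': "integral_coeffs h'" "(f i + (\<Sum>i\<in>I. f i)) ^ p = f i ^ p + (\<Sum>i\<in>I. f i) ^ p + of_nat p * h'"
    using freshman_dream_add[OF p, of "f i" "\<Sum>i\<in>I. f i"] insert.prems integral_coeffs_sum[of I f] by auto
  show ?case
    using insert.hyps h h' by (intro exI[of _ "h + h'"]) (simp add: integral_coeffs_add algebra_simps)
qed

lemma single_pair_power:
  "Poly_Mapping.single (a, b) c ^ n = (Poly_Mapping.single (n * a, n * b) (c ^ n) :: nat \<times> nat \<Rightarrow>\<^sub>0 'c::comm_semiring_1)"
  by (induction n) (simp_all add: mult_single flip: zero_prod_def)

text \<open>
  Modulo \<open>p\<close> the \<open>p\<close>-th power is additive, so \<open>Q ^ p\<close> is congruent to the sum of the \<open>p\<close>-th powers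
  of the monomials of \<open>Q\<close>; these only have exponents divisible by \<open>p\<close>.
\<close>

lemma lookup_prime_power:
  fixes Q :: "nat \<times> nat \<Rightarrow>\<^sub>0 'c::field_char_0"
  assumes p: "prime p" and Q: "integral_coeffs Q"
  shows "\<exists>t. algebraic_int t \<and>
      Poly_Mapping.lookup (Q ^ p) (p * a, p * b) = Poly_Mapping.lookup Q (a, b) ^ p + of_nat p * t"
    and "\<not> p dvd a \<Longrightarrow> \<exists>t. algebraic_int t \<and> Poly_Mapping.lookup (Q ^ p) (a, b) = of_nat p * t"
proof -
  let ?K = "Poly_Mapping.keys Q" and ?c = "Poly_Mapping.lookup Q"
  have p0: "p > 0" using p by (rule prime_gt_0_nat)
  have "\<exists>h. integral_coeffs h \<and> (\<Sum>\<alpha>\<in>?K. Poly_Mapping.single \<alpha> (?c \<alpha>)) ^ p =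
      (\<Sum>\<alpha>\<in>?K. Poly_Mapping.single \<alpha> (?c \<alpha>) ^ p) + of_nat p * h"
    using Q by (intro freshman_dream_sum[OF p] integral_coeffs_single finite_keys)
      (simp only: integral_coeffs_def)
  then obtain h where h: "integral_coeffs h"
    "Q ^ p = (\<Sum>\<alpha>\<in>?K. Poly_Mapping.single \<alpha> (?c \<alpha>) ^ p) + of_nat p * h"
    unfolding poly_mapping_eq_sum_single[of Q, symmetric] by blast
  have "Poly_Mapping.single \<alpha> (?c \<alpha>) ^ p = Poly_Mapping.single (p * fst \<alpha>, p * snd \<alpha>) (?c \<alpha> ^ p)" for \<alpha>
    using single_pair_power[of "fst \<alpha>" "snd \<alpha>" "?c \<alpha>" p] by simp
  moreover have "Poly_Mapping.lookup (of_nat p * h) \<beta> = of_nat p * Poly_Mapping.lookup h \<beta>" for \<beta>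
    using lookup_const_mult[of "of_nat p" h \<beta>] by simp
  ultimately have lookup: "Poly_Mapping.lookup (Q ^ p) \<beta> =
      (\<Sum>\<alpha>\<in>?K. (?c \<alpha> ^ p when (p * fst \<alpha>, p * snd \<alpha>) = \<beta>)) + of_nat p * Poly_Mapping.lookup h \<beta>" for \<beta>
    by (simp add: h(2) lookup_add lookup_sum lookup_single)
  have "(\<Sum>\<alpha>\<in>?K. (?c \<alpha> ^ p when (p * fst \<alpha>, p * snd \<alpha>) = (p * a, p * b))) = (\<Sum>\<alpha>\<in>?K. if \<alpha> = (a, b) then ?c \<alpha> ^ p else 0)"
    using p0 by (intro sum.cong) (auto simp: when_def prod_eq_iff)
  also have "\<dots> = ?c (a, b) ^ p"
    using p0 by (simp add: sum.delta in_keys_iff)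
  finally show "\<exists>t. algebraic_int t \<and>
      Poly_Mapping.lookup (Q ^ p) (p * a, p * b) = Poly_Mapping.lookup Q (a, b) ^ p + of_nat p * t"
    using h(1) lookup[of "(p * a, p * b)"] by (auto simp: integral_coeffs_def)
  assume "\<not> p dvd a"
  then have "(\<Sum>\<alpha>\<in>?K. (?c \<alpha> ^ p when (p * fst \<alpha>, p * snd \<alpha>) = (a, b))) = 0"
    by (intro sum.neutral) (auto simp: when_def)
  then show "\<exists>t. algebraic_int t \<and> Poly_Mapping.lookup (Q ^ p) (a, b) = of_nat p * t"
    using h(1) lookup[of "(a, b)"] by (auto simp: integral_coeffs_def)
qed

text \<open>
  A nonzero \<open>x\<close> would divide a nonzero rational integer \<open>N\<close>; then \<open>N ^ p\<close>, and hence \<open>N\<close>, would be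
  divisible by every prime \<open>p\<close>.
\<close>

lemma algebraic_int_eq_0_if_prime_powers_divisible:
  fixes x :: "'c::field_char_0"
  assumes "algebraic_int x" "\<And>p. prime p \<Longrightarrow> \<exists>t. algebraic_int t \<and> x ^ p = of_nat p * t"
  shows "x = 0"
proof (rule ccontr)
  assume "x \<noteq> 0"
  then obtain N :: int where N: "N \<noteq> 0" "algebraic_int (of_int N / x)"
    using algebraic_int_divides_integer assms(1) by blast
  obtain p :: nat where p: "prime p" "p > nat \<bar>N\<bar>" using bigger_prime by blast
  obtain t where t: "algebraic_int t" "x ^ p = of_nat p * t" using assms(2) p(1) by blast
  have "algebraic_int ((of_int N / x) ^ p * t)"
    using N t by (intro algebraic_int_mult algebraic_int_power)
  also have "(of_int N / x) ^ p * t = of_int (N ^ p) / of_int (int p)"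
  proof -
    have "p \<noteq> 0" using p(1) by (simp add: prime_gt_0_nat)
    then have "t = x ^ p / of_nat p" using t(2) by simp
    then show ?thesis using \<open>x \<noteq> 0\<close> by (simp add: power_divide)
  qed
  finally have "int p dvd N ^ p"
    using p by (intro algebraic_int_quotient_imp_dvd[where 'a = 'c]) (auto simp: prime_gt_0_nat)
  then have "int p dvd N" using p(1) by (meson prime_dvd_power prime_nat_int_transfer)
  then show False using N(1) p(2) dvd_imp_le_int[of N "int p"] by auto
qed

text \<open>
  The Gaussian expectation as a purely algebraic functional; see \<open>gauss_expectation_eq\<close>.
\<close>

definition diagonal_factorial_sum :: "(nat \<times> nat \<Rightarrow>\<^sub>0 'c::semiring_char_0) \<Rightarrow> 'c" where
  "diagonal_factorial_sum f = (\<Sum>\<alpha>\<in>Poly_Mapping.keys f.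
     Poly_Mapping.lookup f \<alpha> * (if fst \<alpha> = snd \<alpha> then fact (fst \<alpha>) else 0))"

text \<open>
  Stated for all large \<open>N\<close>, so that the range of summation can later be chosen to contain a prescribed
  index.
\<close>

lemma diagonal_factorial_sum_eq:
  fixes f :: "nat \<times> nat \<Rightarrow>\<^sub>0 'c::field_char_0"
  shows "\<exists>n. \<forall>N\<ge>n. diagonal_factorial_sum f = (\<Sum>k\<le>N. fact k * Poly_Mapping.lookup f (k, k))"
proof (intro exI allI impI)
  fix N assume N: "N \<ge> Max (insert 0 (fst ` Poly_Mapping.keys f))"
  have le: "k \<le> N" if "(k, k) \<in> Poly_Mapping.keys f" for k
    using N that by (subst (asm) Max_le_iff) (auto simp: image_iff dest: bspec)
  have "diagonal_factorial_sum f = (\<Sum>\<alpha>\<in>(\<lambda>k. (k, k)) ` {..N}. Poly_Mapping.lookup f \<alpha> * fact (fst \<alpha>))"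
    unfolding diagonal_factorial_sum_def
    by (rule sum.mono_neutral_cong) (use le in \<open>auto simp: in_keys_iff\<close>)
  then show "diagonal_factorial_sum f = (\<Sum>k\<le>N. fact k * Poly_Mapping.lookup f (k, k))"
    by (simp add: sum.reindex inj_on_def mult.commute)
qed

text \<open>
  Write \<open>\<gamma>\<close> for the coefficient of \<open>Q\<close> at \<open>(k1, k1)\<close>. For a prime \<open>p\<close>, the functional applied to
  \<open>Q ^ p\<close> starts with the term of \<open>k0 = p * k1\<close>, whose coefficient is congruent to \<open>\<gamma> ^ p\<close> modulo \<open>p\<close>.
  After division by \<open>fact k0\<close> every later term is divisible by \<open>p\<close>: either \<open>p\<close> does not divide \<open>k\<close> and
  the coefficient is divisible by \<open>p\<close>, or \<open>p\<close> divides \<open>k\<close> and \<open>k\<close> is a factor of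
  \<open>fact k / fact k0\<close>. So \<open>\<gamma> ^ p\<close> is divisible by \<open>p\<close>, for every \<open>p\<close>.
\<close>

lemma lowest_diagonal_coeff_eq_0_integral:
  fixes Q :: "nat \<times> nat \<Rightarrow>\<^sub>0 'c::field_char_0"
  assumes Q: "integral_coeffs Q"
    and low: "\<And>j k. k < j * k1 \<Longrightarrow> Poly_Mapping.lookup (Q ^ j) (k, k) = 0"
    and zero: "\<And>j. j \<ge> 1 \<Longrightarrow> diagonal_factorial_sum (Q ^ j) = 0"
  shows "Poly_Mapping.lookup Q (k1, k1) = 0"
proof (rule algebraic_int_eq_0_if_prime_powers_divisible)
  show "algebraic_int (Poly_Mapping.lookup Q (k1, k1))" using Q by (simp add: integral_coeffs_def)
next
  fix p :: nat assume p: "prime p"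
  define s where "s k = Poly_Mapping.lookup (Q ^ p) (k, k)" for k
  define k0 where "k0 = p * k1"
  have "diagonal_factorial_sum (Q ^ p) = 0" using zero p prime_ge_1_nat by blast
  moreover obtain n where
    "\<forall>N\<ge>n. diagonal_factorial_sum (Q ^ p) = (\<Sum>k\<le>N. fact k * s k)"
    using diagonal_factorial_sum_eq[of "Q ^ p"] unfolding s_def by blast
  ultimately have n: "(\<Sum>k\<le>N. fact k * s k) = 0" if "N \<ge> n" for N
    using that by simp
  define N where "N = max n k0"
  have later: "\<exists>t. algebraic_int t \<and> fact k * s k = fact k0 * (of_nat p * t)" if k: "k > k0" for k
  proof -
    have "fact k0 dvd (fact (k - 1) :: nat)" using k by (intro fact_dvd) simp
    then obtain q :: nat where "fact (k - 1) = fact k0 * q" by blast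
    then have fact: "fact k = fact k0 * (q * k)"
      using k fact_reduce[of k, where 'a = nat] by (simp add: mult_ac)
    have fact': "(fact k :: 'c) = fact k0 * of_nat (q * k)"
    proof -
      have "(fact k :: 'c) = of_nat (fact k)" by simp
      also have "\<dots> = of_nat (fact k0 * (q * k))" by (simp only: fact)
      finally show ?thesis by simp
    qed
    have sk: "algebraic_int (s k)"
      using integral_coeffs_power[OF Q, of p] unfolding integral_coeffs_def s_def by blast
    show ?thesis
    proof (cases "p dvd k")
      case True
      then obtain r where r: "k = p * r" by blast
      have "algebraic_int (of_nat (q * r) * s k)"
        using sk by (intro algebraic_int_mult algebraic_int_of_nat)
      then show ?thesis unfolding fact' by (intro exI[of _ "of_nat (q * r) * s k"]) (simp add: r mult_ac)
    next
      case False
      then obtain t where t: "algebraic_int t" "s k = of_nat p * t"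
        using lookup_prime_power(2)[OF p Q False, of k] by (auto simp: s_def)
      then have "algebraic_int (of_nat (q * k) * t)"
        by (intro algebraic_int_mult algebraic_int_of_nat)
      then show ?thesis unfolding fact' t by (intro exI[of _ "of_nat (q * k) * t"]) (simp add: mult_ac)
    qed
  qed
  then have "\<forall>k\<in>{k0<..}. \<exists>t. algebraic_int t \<and> fact k * s k = fact k0 * (of_nat p * t)"
    by simp
  from bchoice[OF this] obtain t where t: "\<And>k. k > k0 \<Longrightarrow> algebraic_int (t k)"
    "\<And>k. k > k0 \<Longrightarrow> fact k * s k = fact k0 * (of_nat p * t k)" by auto
  have "0 = (\<Sum>k\<le>N. fact k * s k)" using n by (simp add: N_def)
  also have "\<dots> = (\<Sum>k\<in>{k0..N}. fact k * s k)"
    using low[of _ p] by (intro sum.mono_neutral_right) (auto simp: s_def k0_def)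
  also have "\<dots> = fact k0 * s k0 + (\<Sum>k\<in>{k0<..N}. fact k * s k)"
    by (subst sum.head) (simp_all add: N_def)
  also have "(\<Sum>k\<in>{k0<..N}. fact k * s k) = fact k0 * (of_nat p * (\<Sum>k\<in>{k0<..N}. t k))"
    using t(2) by (simp add: sum_distrib_left)
  also have "fact k0 * s k0 + \<dots> = fact k0 * (s k0 + of_nat p * (\<Sum>k\<in>{k0<..N}. t k))"
    by (simp add: algebra_simps)
  finally have *: "s k0 + of_nat p * (\<Sum>k\<in>{k0<..N}. t k) = 0" by simp
  obtain t' where t': "algebraic_int t'" "s k0 = Poly_Mapping.lookup Q (k1, k1) ^ p + of_nat p * t'"
    using lookup_prime_power(1)[OF p Q, of k1 k1] by (auto simp: s_def k0_def)
  have "algebraic_int (- (t' + (\<Sum>k\<in>{k0<..N}. t k)))"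
    using t' t(1) by (intro algebraic_int_minus algebraic_int_add algebraic_int_sum) auto
  moreover have "Poly_Mapping.lookup Q (k1, k1) ^ p = of_nat p * (- (t' + (\<Sum>k\<in>{k0<..N}. t k)))"
    using * t'(2) by (simp add: algebra_simps eq_neg_iff_add_eq_0)
  ultimately show "\<exists>t. algebraic_int t \<and> Poly_Mapping.lookup Q (k1, k1) ^ p = of_nat p * t" by blast
qed

text \<open>
  Clearing denominators reduces algebraic coefficients to integral ones, since everything in sight is
  homogeneous in \<open>P\<close>.
\<close>

lemma lowest_diagonal_coeff_eq_0:
  fixes P :: "nat \<times> nat \<Rightarrow>\<^sub>0 'c::field_char_0"
  assumes P: "\<And>\<alpha>. algebraic (Poly_Mapping.lookup P \<alpha>)"
    and low: "\<And>j k. k < j * k1 \<Longrightarrow> Poly_Mapping.lookup (P ^ (m * j)) (k, k) = 0"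
    and zero: "\<And>j. j \<ge> 1 \<Longrightarrow> diagonal_factorial_sum (P ^ (m * j)) = 0"
  shows "Poly_Mapping.lookup (P ^ m) (k1, k1) = 0"
proof -
  obtain D :: nat where D: "D > 0"
    "\<And>x. x \<in> Poly_Mapping.lookup P ` Poly_Mapping.keys P \<Longrightarrow> algebraic_int (of_nat D * x)"
    using algebraic_finite_common_denominator[of "Poly_Mapping.lookup P ` Poly_Mapping.keys P"] P
    by (metis finite_imageI finite_keys imageE)
  define P' where "P' = Poly_Mapping.single 0 (of_nat D) * P"
  have "Poly_Mapping.single (0 :: nat \<times> nat) (of_nat D :: 'c) ^ j = Poly_Mapping.single 0 (of_nat D ^ j)" for j
    using single_pair_power[of 0 0 "of_nat D :: 'c" j] by (simp flip: zero_prod_def)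
  then have lookup: "Poly_Mapping.lookup (P' ^ j) \<alpha> = of_nat D ^ j * Poly_Mapping.lookup (P ^ j) \<alpha>" for j \<alpha>
    by (simp add: P'_def power_mult_distrib lookup_const_mult)
  have keys: "Poly_Mapping.keys (P' ^ j) = Poly_Mapping.keys (P ^ j)" for j
    using D(1) by (auto simp: in_keys_iff lookup)
  have "Poly_Mapping.lookup (P' ^ m) (k1, k1) = 0"
  proof (rule lowest_diagonal_coeff_eq_0_integral)
    have "algebraic_int (of_nat D * Poly_Mapping.lookup P \<alpha>)" for \<alpha>
      using D(2)[of "Poly_Mapping.lookup P \<alpha>"] by (cases "\<alpha> \<in> Poly_Mapping.keys P") (auto simp: in_keys_iff)
    then have "integral_coeffs P'" unfolding integral_coeffs_def P'_def lookup_const_mult by blast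
    then show "integral_coeffs (P' ^ m)" by (rule integral_coeffs_power)
    show "Poly_Mapping.lookup ((P' ^ m) ^ j) (k, k) = 0" if "k < j * k1" for j k
      using low[OF that] by (simp add: lookup flip: power_mult)
    show "diagonal_factorial_sum ((P' ^ m) ^ j) = 0" if "j \<ge> 1" for j
      using zero[OF that] unfolding diagonal_factorial_sum_def power_mult[symmetric] keys lookup
      by (simp add: mult.assoc flip: sum_distrib_left)
  qed
  then show ?thesis using D(1) lookup[of m] by simp
qed

section \<open>Gaussian moments\<close>

definition std_normal_moment :: "nat \<Rightarrow> real" where
  "std_normal_moment n = (if even n then fact n / (2 ^ (n div 2) * fact (n div 2)) else 0)"

text \<open>
  The moment of order \<open>n\<close> of \<open>u * X + v * Y\<close> for independent standard normal \<open>X\<close> and \<open>Y\<close>, but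
  with complex \<open>u\<close> and \<open>v\<close>. Only even \<open>k\<close> contribute, and for these the moments turn the binomial
  coefficient of \<open>(2 m, 2 j)\<close> into that of \<open>(m, j)\<close>, so that the binomial theorem applies to the
  squares.
\<close>

lemma std_normal_moment_convolution:
  fixes u v :: complex
  shows "(\<Sum>k\<le>n. of_nat (n choose k) * u ^ k * v ^ (n - k) *
            complex_of_real (std_normal_moment k * std_normal_moment (n - k))) =
         of_real (std_normal_moment n) * (u ^ 2 + v ^ 2) ^ (n div 2)"
proof (cases "even n")
  case False
  then have "std_normal_moment k * std_normal_moment (n - k) = 0" if "k \<le> n" for k
    using that by (auto simp: std_normal_moment_def)
  then have "(\<Sum>k\<le>n. of_nat (n choose k) * u ^ k * v ^ (n - k) *
            complex_of_real (std_normal_moment k * std_normal_moment (n - k))) = 0"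
    by (intro sum.neutral ballI) (metis atMost_iff mult_zero_right of_real_0)
  moreover have "std_normal_moment n = 0"
    using False by (simp add: std_normal_moment_def)
  ultimately show ?thesis by simp
next
  case True
  then obtain m where n: "n = 2 * m" by blast
  define T where "T k = of_nat (n choose k) * u ^ k * v ^ (n - k) *
            complex_of_real (std_normal_moment k * std_normal_moment (n - k))" for k
  have "(\<Sum>k\<le>n. T k) = (\<Sum>k\<in>(\<lambda>j. 2 * j) ` {..m}. T k)"
  proof (rule sum.mono_neutral_right)
    show "\<forall>k\<in>{..n} - (\<lambda>j. 2 * j) ` {..m}. T k = 0"
    proof
      fix k assume k: "k \<in> {..n} - (\<lambda>j. 2 * j) ` {..m}"
      have "odd k"
      proof
        assume "even k"
        then obtain j where "k = 2 * j" by blast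
        with k n show False by auto
      qed
      then show "T k = 0" by (simp add: T_def std_normal_moment_def)
    qed
  qed (auto simp: n)
  also have "\<dots> = (\<Sum>j\<le>m. T (2 * j))"
    by (subst sum.reindex) (auto simp: inj_on_def)
  also have "\<dots> = (\<Sum>j\<le>m. of_real (std_normal_moment n) *
      (of_nat (m choose j) * (u ^ 2) ^ j * (v ^ 2) ^ (m - j)))"
  proof (rule sum.cong)
    fix j assume "j \<in> {..m}"
    then have j: "j \<le> m" by simp
    have e: "n - 2 * j = 2 * (m - j)" using n j by simp
    have "real (n choose (2 * j)) * (std_normal_moment (2 * j) * std_normal_moment (n - 2 * j)) =
          std_normal_moment n * real (m choose j)"
    proof -
      have p2: "(2::real) ^ m = 2 ^ j * 2 ^ (m - j)" using j by (simp add: power_add[symmetric])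
      have b1: "real (n choose (2 * j)) = fact n / (fact (2 * j) * fact (n - 2 * j))"
        using j n by (intro binomial_fact) auto
      have b2: "real (m choose j) = fact m / (fact j * fact (m - j))"
        using j by (intro binomial_fact) auto
      show ?thesis
        unfolding b1 b2 std_normal_moment_def e using n p2 by (simp add: field_simps)
    qed
    then have "complex_of_real (real (n choose (2 * j)) * (std_normal_moment (2 * j) * std_normal_moment (n - 2 * j))) =
          of_real (std_normal_moment n * real (m choose j))" by simp
    then show "T (2 * j) = of_real (std_normal_moment n) *
      (of_nat (m choose j) * (u ^ 2) ^ j * (v ^ 2) ^ (m - j))"
      unfolding T_def e power_mult[symmetric] by (simp add: mult_ac)
  qed simp
  also have "\<dots> = of_real (std_normal_moment n) * (u ^ 2 + v ^ 2) ^ (n div 2)"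
    by (simp add: n binomial_ring sum_distrib_left)
  finally show ?thesis by (simp add: T_def)
qed

context prob_space
begin

lemma std_normal_has_moment:
  assumes "distributed M lborel X std_normal_density"
  shows "has_bochner_integral M (\<lambda>\<omega>. X \<omega> ^ n) (std_normal_moment n)"
proof -
  have "has_bochner_integral lborel (\<lambda>x. std_normal_density x * x ^ n) (std_normal_moment n)"
  proof (cases "even n")
    case True
    then show ?thesis using std_normal_moment_even[of "n div 2"] by (simp add: std_normal_moment_def)
  next
    case False
    then show ?thesis using std_normal_moment_odd[of "n div 2"] by (simp add: std_normal_moment_def)
  qed
  then have "integrable lborel (\<lambda>x. std_normal_density x * x ^ n)"
    "(\<integral>x. std_normal_density x * x ^ n \<partial>lborel) = std_normal_moment n"
    by (auto simp: has_bochner_integral_iff)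
  moreover have "integrable lborel (\<lambda>x. std_normal_density x * x ^ n) \<longleftrightarrow> integrable M (\<lambda>\<omega>. X \<omega> ^ n)"
    by (rule distributed_integrable[OF assms]) auto
  moreover have "(\<integral>x. std_normal_density x * x ^ n \<partial>lborel) = (\<integral>\<omega>. X \<omega> ^ n \<partial>M)"
    by (rule distributed_integral[OF assms]) auto
  ultimately show ?thesis by (simp add: has_bochner_integral_iff)
qed

context
  fixes X Y :: "'a \<Rightarrow> real"
  assumes X: "distributed M lborel X std_normal_density"
    and Y: "distributed M lborel Y std_normal_density"
    and indep: "indep_var borel X borel Y"
begin

lemma has_joint_moment:
  "has_bochner_integral M (\<lambda>\<omega>. complex_of_real (X \<omega>) ^ i * of_real (Y \<omega>) ^ j)
     (of_real (std_normal_moment i * std_normal_moment j))"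
proof -
  have ind: "indep_var borel (\<lambda>\<omega>. X \<omega> ^ i) borel (\<lambda>\<omega>. Y \<omega> ^ j)"
    using indep_var_compose[OF indep, of "\<lambda>x. x ^ i" borel "\<lambda>x. x ^ j" borel]
    by (simp add: comp_def)
  have "integrable M (\<lambda>\<omega>. X \<omega> ^ i)" "integrable M (\<lambda>\<omega>. Y \<omega> ^ j)"
    "expectation (\<lambda>\<omega>. X \<omega> ^ i) = std_normal_moment i" "expectation (\<lambda>\<omega>. Y \<omega> ^ j) = std_normal_moment j"
    using std_normal_has_moment[OF X, of i] std_normal_has_moment[OF Y, of j]
    by (auto simp: has_bochner_integral_iff)
  then have "has_bochner_integral M (\<lambda>\<omega>. X \<omega> ^ i * Y \<omega> ^ j) (std_normal_moment i * std_normal_moment j)"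
    using indep_var_lebesgue_integral[OF ind] indep_var_integrable[OF ind]
    by (simp add: has_bochner_integral_iff)
  from has_bochner_integral_bounded_linear[OF bounded_linear_of_real[where 'a = complex] this]
  show ?thesis by simp
qed

lemma expectation_linear_form_power:
  fixes u v :: complex
  shows "(\<integral>\<omega>. (u * X \<omega> + v * Y \<omega>) ^ n \<partial>M) =
         of_real (std_normal_moment n) * (u ^ 2 + v ^ 2) ^ (n div 2)"
proof -
  have "has_bochner_integral M
    (\<lambda>\<omega>. \<Sum>k\<le>n. of_nat (n choose k) * u ^ k * v ^ (n - k) * (complex_of_real (X \<omega>) ^ k * of_real (Y \<omega>) ^ (n - k)))
    (\<Sum>k\<le>n. of_nat (n choose k) * u ^ k * v ^ (n - k) * of_real (std_normal_moment k * std_normal_moment (n - k)))"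
    by (intro has_bochner_integral_sum has_bochner_integral_mult_right has_joint_moment)
  moreover have "(u * X \<omega> + v * Y \<omega>) ^ n = (\<Sum>k\<le>n. of_nat (n choose k) * u ^ k * v ^ (n - k) *
      (complex_of_real (X \<omega>) ^ k * of_real (Y \<omega>) ^ (n - k)))" for \<omega>
    by (simp add: binomial_ring power_mult_distrib mult_ac)
  ultimately show ?thesis
    by (simp add: has_bochner_integral_iff std_normal_moment_convolution del: of_real_mult)
qed

definition Z :: "'a \<Rightarrow> complex" where
  "Z \<omega> = (complex_of_real (X \<omega>) + \<i> * complex_of_real (Y \<omega>)) / complex_of_real (sqrt 2)"

definition W :: "'a \<Rightarrow> complex" where
  "W \<omega> = (complex_of_real (X \<omega>) - \<i> * complex_of_real (Y \<omega>)) / complex_of_real (sqrt 2)"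

lemma integrable_monomial: "integrable M (\<lambda>\<omega>. Z \<omega> ^ a * W \<omega> ^ b)"
proof -
  have "integrable M (\<lambda>\<omega>. of_real (X \<omega>) ^ i * of_real (Y \<omega>) ^ j * W \<omega> ^ b)" for i j
  proof (induction b arbitrary: i j)
    case 0
    show ?case using has_joint_moment[of i j] by (simp add: has_bochner_integral_iff)
  next
    case (Suc b)
    have "integrable M (\<lambda>\<omega>. (of_real (X \<omega>) ^ Suc i * of_real (Y \<omega>) ^ j * W \<omega> ^ b
        - \<i> * (of_real (X \<omega>) ^ i * of_real (Y \<omega>) ^ Suc j * W \<omega> ^ b)) / complex_of_real (sqrt 2))"
      by (intro integrable_divide Bochner_Integration.integrable_diff integrable_mult_right Suc)
    then show ?case
      by (rule Bochner_Integration.integrable_cong[THEN iffD1, rotated 2])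
         (simp_all add: W_def algebra_simps diff_divide_distrib)
  qed
  then have "integrable M (\<lambda>\<omega>. of_real (X \<omega>) ^ i * of_real (Y \<omega>) ^ j * Z \<omega> ^ a * W \<omega> ^ b)" for i j
  proof (induction a arbitrary: i j)
    case 0
    then show ?case by simp
  next
    case (Suc a)
    have "integrable M (\<lambda>\<omega>. (of_real (X \<omega>) ^ Suc i * of_real (Y \<omega>) ^ j * Z \<omega> ^ a * W \<omega> ^ b
        + \<i> * (of_real (X \<omega>) ^ i * of_real (Y \<omega>) ^ Suc j * Z \<omega> ^ a * W \<omega> ^ b)) / complex_of_real (sqrt 2))"
      by (intro integrable_divide Bochner_Integration.integrable_add integrable_mult_right Suc)
    then show ?case
      by (rule Bochner_Integration.integrable_cong[THEN iffD1, rotated 2])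
         (simp_all add: Z_def algebra_simps add_divide_distrib)
  qed
  from this[of 0 0] show ?thesis by simp
qed

text \<open>
  With \<open>u = (s + 1) / sqrt 2\<close> and \<open>v = \<i> * (s - 1) / sqrt 2\<close> the linear form \<open>u * X + v * Y\<close> is
  \<open>s * Z + W\<close>, and \<open>u\<^sup>2 + v\<^sup>2 = 2 * s\<close>. So the expectation of \<open>(s * Z + W) ^ n\<close> is a multiple of a
  single power of \<open>s\<close>, and comparing coefficients of the powers of \<open>s\<close> gives all expectations
  of monomials of degree \<open>n\<close>.
\<close>

lemma expectation_monomial:
  "(\<integral>\<omega>. Z \<omega> ^ a * W \<omega> ^ b \<partial>M) = (if a = b then fact a else 0)"
proof -
  define n where "n = a + b"
  define e where "e k = of_nat (n choose k) * (\<integral>\<omega>. Z \<omega> ^ k * W \<omega> ^ (n - k) \<partial>M)" for k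
  define d :: "nat \<Rightarrow> complex" where
    "d k = (if n = 2 * k then of_real (std_normal_moment n) * 2 ^ k else 0)" for k
  have "(\<Sum>k\<le>n. e k * s ^ k) = (\<Sum>k\<le>n. d k * s ^ k)" for s
  proof -
    define u v where "u = (s + 1) / complex_of_real (sqrt 2)" and "v = \<i> * (s - 1) / complex_of_real (sqrt 2)"
    have sq: "complex_of_real (sqrt 2) ^ 2 = 2" by (metis of_real_numeral of_real_power real_sqrt_pow2 zero_le_numeral)
    have uv: "u ^ 2 + v ^ 2 = 2 * s"
      unfolding u_def v_def power_divide power_mult_distrib sq by (simp add: power2_eq_square field_simps)
    have "(\<Sum>k\<le>n. e k * s ^ k) = (\<integral>\<omega>. (\<Sum>k\<le>n. of_nat (n choose k) * s ^ k * (Z \<omega> ^ k * W \<omega> ^ (n - k))) \<partial>M)"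
      by (subst Bochner_Integration.integral_sum) (simp_all add: integrable_monomial e_def mult_ac)
    also have "\<dots> = (\<integral>\<omega>. (u * X \<omega> + v * Y \<omega>) ^ n \<partial>M)"
    proof (intro Bochner_Integration.integral_cong refl)
      fix \<omega>
      have "u * X \<omega> + v * Y \<omega> = s * Z \<omega> + W \<omega>"
        by (simp add: u_def v_def Z_def W_def field_simps)
      then show "(\<Sum>k\<le>n. of_nat (n choose k) * s ^ k * (Z \<omega> ^ k * W \<omega> ^ (n - k))) = (u * X \<omega> + v * Y \<omega>) ^ n"
        by (simp add: binomial_ring power_mult_distrib mult_ac)
    qed
    also have "\<dots> = of_real (std_normal_moment n) * (2 * s) ^ (n div 2)"
      by (simp add: expectation_linear_form_power uv)
    also have "\<dots> = (\<Sum>k\<le>n. d k * s ^ k)"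
    proof (cases "even n")
      case False
      then show ?thesis by (auto simp: d_def std_normal_moment_def intro!: sum.neutral)
    next
      case True
      have "(\<Sum>k\<le>n. d k * s ^ k) = (\<Sum>k\<in>{n div 2}. d k * s ^ k)"
        using True by (intro sum.mono_neutral_right) (auto simp: d_def)
      then show ?thesis using True by (simp add: d_def power_mult_distrib)
    qed
    finally show ?thesis .
  qed
  then have "e a = d a" using polyfun_eq_coeffs[of e n d] by (simp add: n_def)
  then have *: "of_nat (n choose a) * (\<integral>\<omega>. Z \<omega> ^ a * W \<omega> ^ b \<partial>M) = d a"
    by (simp add: e_def n_def)
  show ?thesis
  proof (cases "a = b")
    case False
    then show ?thesis using * by (simp add: d_def n_def)
  next
    case True
    have "real (n choose a) = fact n / (fact a * fact a)"
      using binomial_fact[of a n, where 'a = real] True by (simp add: n_def)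
    then have "std_normal_moment n * 2 ^ a = real (n choose a) * fact a"
      using True by (simp add: std_normal_moment_def n_def)
    then have "complex_of_real (std_normal_moment n * 2 ^ a) = of_real (real (n choose a) * fact a)"
      by (simp only:)
    then have "d a = of_nat (n choose a) * fact a" using True by (simp add: d_def n_def)
    moreover have "n choose a \<noteq> 0" by (simp add: n_def)
    ultimately show ?thesis using * True by simp
  qed
qed

lemma gauss_expectation_eq:
  "gauss_expectation M X Y P =
     (\<Sum>\<alpha>\<in>Poly_Mapping.keys P. Poly_Mapping.lookup P \<alpha> * (if fst \<alpha> = snd \<alpha> then fact (fst \<alpha>) else 0))"
proof -
  have "gauss_expectation M X Y P =
    (\<integral>\<omega>. (\<Sum>\<alpha>\<in>Poly_Mapping.keys P. Poly_Mapping.lookup P \<alpha> * (Z \<omega> ^ fst \<alpha> * W \<omega> ^ snd \<alpha>)) \<partial>M)"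
    unfolding gauss_expectation_def eval_ZW_def Z_def[symmetric] W_def[symmetric]
    by (intro Bochner_Integration.integral_cong refl sum.cong) (auto simp: mult.assoc)
  also have "\<dots> = (\<Sum>\<alpha>\<in>Poly_Mapping.keys P. Poly_Mapping.lookup P \<alpha> * (\<integral>\<omega>. Z \<omega> ^ fst \<alpha> * W \<omega> ^ snd \<alpha> \<partial>M))"
    by (subst Bochner_Integration.integral_sum) (simp_all add: integrable_monomial)
  finally show ?thesis by (simp add: expectation_monomial)
qed

end
end

section \<open>Means over roots of unity and the roots of a polynomial\<close>

definition root_of_unity :: "nat \<Rightarrow> nat \<Rightarrow> complex" where
  "root_of_unity M j = cis (2 * pi * real j / real M)"

definition unity_mean :: "nat \<Rightarrow> (complex \<Rightarrow> real) \<Rightarrow> real" where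
  "unity_mean M h = (\<Sum>j<M. h (root_of_unity M j)) / real M"

lemma norm_root_of_unity [simp]: "norm (root_of_unity M j) = 1"
  by (simp add: root_of_unity_def)

text \<open>
  The hypotheses say that \<open>i - m\<close> is a nonzero integer of absolute value less than \<open>M\<close>; they are
  written this way because exponents are natural numbers.
\<close>

lemma sum_root_of_unity_powers:
  assumes "i < M + m" "m < M + i" "i \<noteq> m"
  shows "(\<Sum>j<M. root_of_unity M j ^ i * inverse (root_of_unity M j) ^ m) = 0"
proof -
  define k where "k = int i - int m"
  define \<omega> where "\<omega> = cis (2 * pi * of_int k / real M)"
  have M: "M > 0" using assms by linarith
  have k: "k \<noteq> 0" "\<bar>k\<bar> < int M" using assms unfolding k_def by auto
  have "root_of_unity M j ^ i * inverse (root_of_unity M j) ^ m = \<omega> ^ j" for j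
  proof -
    define t where "t = 2 * pi * real j / real M"
    have "root_of_unity M j ^ i * inverse (root_of_unity M j) ^ m = cis (real i * t + real m * - t)"
      by (simp only: root_of_unity_def t_def[symmetric] cis_inverse Complex.DeMoivre cis_mult)
    also have "real i * t + real m * - t = real j * (2 * pi * of_int k / real M)"
      using M by (simp add: t_def k_def field_simps)
    finally show ?thesis by (simp only: \<omega>_def Complex.DeMoivre)
  qed
  moreover have "\<omega> \<noteq> 1"
  proof
    assume "\<omega> = 1"
    then obtain n :: int where "2 * pi * of_int k / real M = of_int n * (2 * pi)"
      unfolding \<omega>_def cis_eq_1_iff by blast
    then have "of_int k = (of_int n * real M :: real)" using M by (simp add: field_simps)
    then have "k = n * int M" by (metis of_int_eq_iff of_int_mult of_int_of_nat_eq)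
    then have "int M dvd k" by simp
    from dvd_imp_le_int[OF k(1) this] k(2) show False by simp
  qed
  moreover have "\<omega> ^ M = 1"
    using M cis_multiple_2pi[of "of_int k"] by (simp add: \<omega>_def Complex.DeMoivre)
  ultimately show ?thesis by (simp add: geometric_sum)
qed

text \<open>
  Exponents of the \<open>n\<close>-th power of the Laurent polynomial \<open>G z / z ^ \<rho>\<close> lie between \<open>- N * n\<close> and
  \<open>N * n\<close>. Averaging over roots of unity of order \<open>N * K > N * n\<close> therefore isolates its constant
  term.
\<close>

lemma sum_laurent_power_root_of_unity:
  fixes G :: "complex poly"
  assumes "degree G \<le> N" "\<rho> \<le> N" "coeff (G ^ n) (\<rho> * n) = 0" "n < K"
  shows "(\<Sum>j<N * K. (poly G (root_of_unity (N * K) j) * inverse (root_of_unity (N * K) j) ^ \<rho>) ^ n) = 0"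
proof -
  let ?z = "root_of_unity (N * K)"
  have deg: "degree (G ^ n) \<le> N * n"
    using degree_power_le[of G n] assms(1) by (meson le_trans mult_le_mono1)
  have "(poly G (?z j) * inverse (?z j) ^ \<rho>) ^ n =
      (\<Sum>i\<le>N * n. coeff (G ^ n) i * (?z j ^ i * inverse (?z j) ^ (\<rho> * n)))" for j
  proof -
    have "(poly G (?z j) * inverse (?z j) ^ \<rho>) ^ n = poly (G ^ n) (?z j) * inverse (?z j) ^ (\<rho> * n)"
      by (simp add: power_mult_distrib power_mult)
    also have "poly (G ^ n) (?z j) = (\<Sum>i\<le>N * n. coeff (G ^ n) i * ?z j ^ i)"
      unfolding poly_altdef using deg by (intro sum.mono_neutral_left) (auto simp: coeff_eq_0)
    finally show ?thesis by (simp add: sum_distrib_right mult.assoc)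
  qed
  then have "(\<Sum>j<N * K. (poly G (?z j) * inverse (?z j) ^ \<rho>) ^ n) =
      (\<Sum>i\<le>N * n. coeff (G ^ n) i * (\<Sum>j<N * K. ?z j ^ i * inverse (?z j) ^ (\<rho> * n)))"
    by (simp add: sum_distrib_left sum.swap[of _ "{..<N * K}"])
  also have "\<dots> = 0"
  proof (intro sum.neutral ballI)
    fix i assume "i \<in> {..N * n}"
    then have i: "i \<le> N * n" by simp
    have r: "\<rho> * n \<le> N * n" using assms(2) by simp
    show "coeff (G ^ n) i * (\<Sum>j<N * K. ?z j ^ i * inverse (?z j) ^ (\<rho> * n)) = 0"
    proof (cases "i = \<rho> * n")
      case True
      then show ?thesis using assms(3) by simp
    next
      case False
      then have "N > 0" using i r by (intro gr0I) auto
      then have "N * n < N * K" using assms(4) by simp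
      then have "i < N * K + \<rho> * n" "\<rho> * n < N * K + i" using i r by linarith+
      then show ?thesis using False by (simp add: sum_root_of_unity_powers)
    qed
  qed
  finally show ?thesis .
qed

text \<open>
  Expand the logarithm of \<open>1 - u\<close>, where \<open>u = G z / z ^ \<rho>\<close>, in powers of \<open>u\<close>. The powers with
  \<open>n < K\<close> have mean zero, and the others are bounded by a geometric tail.
\<close>

lemma unity_mean_log_bound:
  fixes G :: "complex poly"
  assumes "degree G \<le> N" "\<rho> \<le> N" "\<And>n. n \<ge> 1 \<Longrightarrow> coeff (G ^ n) (\<rho> * n) = 0"
    and \<theta>: "\<And>z. norm z = 1 \<Longrightarrow> norm (poly G z) \<le> \<theta>" "\<theta> < 1" and "N > 0" "K > 0"
  shows "\<bar>unity_mean (N * K) (\<lambda>z. ln (norm (1 - poly G z * inverse z ^ \<rho>)))\<bar> \<le> \<theta> ^ K / (1 - \<theta>)"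
proof -
  define M where "M = N * K"
  have M: "M > 0" using assms by (simp add: M_def)
  define u where "u j = poly G (root_of_unity M j) * inverse (root_of_unity M j) ^ \<rho>" for j
  have \<theta>0: "\<theta> \<ge> 0" using \<theta>(1)[of 1] by (meson norm_ge_zero norm_one order_trans)
  have u: "norm (u j) \<le> \<theta>" for j
    using \<theta>(1)[of "root_of_unity M j"] by (simp add: u_def norm_mult norm_power norm_inverse)
  have "(\<lambda>n. \<Sum>j<M. - (u j ^ n / of_nat n)) sums (\<Sum>j<M. Ln (1 - u j))"
  proof (rule sums_sum)
    fix j
    have "norm (- u j) < 1" using u[of j] \<theta>(2) by simp
    from Ln_series'[OF this] show "(\<lambda>n. - (u j ^ n / of_nat n)) sums Ln (1 - u j)" by simp
  qed
  then have sums: "(\<lambda>n. - (\<Sum>j<M. u j ^ n) / of_nat n) sums (\<Sum>j<M. Ln (1 - u j))"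
    by (simp add: sum_negf sum_divide_distrib)
  have vanish: "- (\<Sum>j<M. u j ^ n) / of_nat n = 0" if "n < K" for n
  proof (cases "n = 0")
    case False
    then have "(\<Sum>j<M. u j ^ n) = 0"
      unfolding u_def M_def using assms that by (intro sum_laurent_power_root_of_unity) auto
    then show ?thesis by simp
  qed simp
  have tail: "norm (- (\<Sum>j<M. u j ^ n) / of_nat n) \<le> real M * \<theta> ^ n" for n
  proof -
    have "norm (\<Sum>j<M. u j ^ n) \<le> (\<Sum>j<M. \<theta> ^ n)"
      by (rule order_trans[OF norm_sum]) (intro sum_mono, simp add: norm_power power_mono u)
    then have *: "norm (\<Sum>j<M. u j ^ n) \<le> real M * \<theta> ^ n" by simp
    show ?thesis
    proof (cases "n = 0")
      case False
      then have "norm (\<Sum>j<M. u j ^ n) / real n \<le> norm (\<Sum>j<M. u j ^ n)"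
        by (simp add: divide_le_eq mult_le_cancel_left1)
      then show ?thesis using * by (simp add: norm_divide)
    qed simp
  qed
  have shifted: "(\<lambda>n. - (\<Sum>j<M. u j ^ (n + K)) / of_nat (n + K)) sums (\<Sum>j<M. Ln (1 - u j))"
    using sums_zero_iff_shift[of K "\<lambda>n. - (\<Sum>j<M. u j ^ n) / of_nat n"] vanish sums by blast
  have geo: "(\<lambda>n. real M * \<theta> ^ (n + K)) sums (real M * (\<theta> ^ K / (1 - \<theta>)))"
    using sums_mult[OF geometric_sums[of \<theta>], of "real M * \<theta> ^ K"] \<theta>0 \<theta>(2)
    by (simp add: power_add mult_ac)
  have "norm (\<Sum>j<M. Ln (1 - u j)) \<le> real M * (\<theta> ^ K / (1 - \<theta>))"
    using norm_suminf_le[OF tail sums_summable[OF geo]] shifted geo by (simp add: sums_iff)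
  moreover have "(\<Sum>j<M. ln (norm (1 - u j))) = Re (\<Sum>j<M. Ln (1 - u j))"
  proof -
    have "1 - u j \<noteq> 0" for j using u[of j] \<theta>(2) by auto
    then show ?thesis by (simp add: Re_sum Re_Ln)
  qed
  ultimately have "\<bar>\<Sum>j<M. ln (norm (1 - u j))\<bar> \<le> real M * (\<theta> ^ K / (1 - \<theta>))"
    using abs_Re_le_cmod order_trans by metis
  then show ?thesis
    using M unfolding unity_mean_def M_def[symmetric] u_def[symmetric]
    by (simp add: abs_divide divide_le_eq mult.commute)
qed

lemma unity_mean_log_tendsto_0:
  fixes G :: "complex poly"
  assumes "degree G \<le> N" "\<rho> \<le> N" "\<And>n. n \<ge> 1 \<Longrightarrow> coeff (G ^ n) (\<rho> * n) = 0"
    and \<theta>: "\<And>z. norm z = 1 \<Longrightarrow> norm (poly G z) \<le> \<theta>" "\<theta> < 1" and "N > 0"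
  shows "(\<lambda>K. unity_mean (N * K) (\<lambda>z. ln (norm (1 - poly G z * inverse z ^ \<rho>)))) \<longlonglongrightarrow> 0"
proof (rule Lim_null_comparison)
  show "\<forall>\<^sub>F K in sequentially. norm (unity_mean (N * K) (\<lambda>z. ln (norm (1 - poly G z * inverse z ^ \<rho>)))) \<le> \<theta> ^ K / (1 - \<theta>)"
    using eventually_gt_at_top[of 0]
    by eventually_elim (use unity_mean_log_bound[OF assms] in simp)
  have "\<theta> \<ge> 0" using \<theta>(1)[of 1] by (meson norm_ge_zero norm_one order_trans)
  then have "(\<lambda>K. \<theta> ^ K) \<longlonglongrightarrow> 0" using \<theta>(2) by (intro LIMSEQ_realpow_zero) auto
  then show "(\<lambda>K. \<theta> ^ K / (1 - \<theta>)) \<longlonglongrightarrow> 0" using tendsto_divide_0 tendsto_divide[of _ 0 _ _ "1 - \<theta>"] \<theta>(2) by fastforce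
qed

lemma unity_mean_cong:
  "(\<And>z. norm z = 1 \<Longrightarrow> f z = g z) \<Longrightarrow> unity_mean M f = unity_mean M g"
  unfolding unity_mean_def by simp

lemma unity_mean_add: "unity_mean M (\<lambda>z. f z + g z) = unity_mean M f + unity_mean M g"
  unfolding unity_mean_def by (simp add: sum.distrib add_divide_distrib)

lemma unity_mean_const: "M > 0 \<Longrightarrow> unity_mean M (\<lambda>z. c) = c"
  unfolding unity_mean_def by simp

lemma unity_mean_const_add_tendsto:
  assumes "(\<lambda>K. unity_mean (N * K) f) \<longlonglongrightarrow> L" "N > 0"
  shows "(\<lambda>K. unity_mean (N * K) (\<lambda>z. c + f z)) \<longlonglongrightarrow> c + L"
proof (rule Lim_transform_eventually)
  show "(\<lambda>K. c + unity_mean (N * K) f) \<longlonglongrightarrow> c + L"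
    using assms(1) by (intro tendsto_intros)
  show "\<forall>\<^sub>F K in sequentially. c + unity_mean (N * K) f = unity_mean (N * K) (\<lambda>z. c + f z)"
    using eventually_gt_at_top[of 0]
    by eventually_elim (use assms(2) in \<open>simp add: unity_mean_add unity_mean_const\<close>)
qed

text \<open>
  A discrete Jensen formula. Both cases are instances of \<open>unity_mean_log_tendsto_0\<close>, with \<open>a / z\<close> or
  \<open>z / a\<close> as the Laurent polynomial.
\<close>

lemma unity_mean_log_linear:
  fixes a :: complex
  assumes "norm a \<noteq> 1" "N > 0"
  shows "(\<lambda>K. unity_mean (N * K) (\<lambda>z. ln (norm (z - a)))) \<longlonglongrightarrow> ln (max 1 (norm a))"
proof (cases "norm a < 1")
  case True
  have "(\<lambda>K. unity_mean (N * K) (\<lambda>z. ln (norm (1 - poly [:a:] z * inverse z ^ 1)))) \<longlonglongrightarrow> 0"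
  proof (rule unity_mean_log_tendsto_0)
    show "coeff ([:a:] ^ n) (1 * n) = 0" if "n \<ge> 1" for n
    proof -
      have "[:a:] ^ n = [:a ^ n:]" by (induction n) (simp_all add: one_pCons)
      then show ?thesis using that by (cases n) auto
    qed
  qed (use assms True in auto)
  moreover have "norm (1 - poly [:a:] z * inverse z ^ 1) = norm (z - a)" if "norm z = 1" for z
  proof -
    have "z \<noteq> 0" using that by auto
    then have "1 - poly [:a:] z * inverse z ^ 1 = (z - a) / z" by (simp add: field_simps)
    then show ?thesis using that by (simp add: norm_divide)
  qed
  ultimately have "(\<lambda>K. unity_mean (N * K) (\<lambda>z. ln (norm (z - a)))) \<longlonglongrightarrow> 0"
    by (simp cong: unity_mean_cong)
  then show ?thesis using True by (simp add: max_def)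
next
  case False
  then have a: "norm a > 1" using assms by simp
  then have "a \<noteq> 0" by auto
  have "(\<lambda>K. unity_mean (N * K) (\<lambda>z. ln (norm (1 - poly [:0, 1 / a:] z * inverse z ^ 0)))) \<longlonglongrightarrow> 0"
  proof (rule unity_mean_log_tendsto_0)
    show "coeff ([:0, 1 / a:] ^ n) (0 * n) = 0" if "n \<ge> 1" for n
      using that by (simp add: coeff_0_power power_0_left)
    show "norm (poly [:0, 1 / a:] z) \<le> 1 / norm a" if "norm z = 1" for z
      using that by (simp add: norm_mult norm_divide)
    show "1 / norm a < 1" using a by (simp add: divide_less_eq)
  qed (use assms in auto)
  then have "(\<lambda>K. unity_mean (N * K) (\<lambda>z. ln (norm a) + ln (norm (1 - poly [:0, 1 / a:] z * inverse z ^ 0))))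
      \<longlonglongrightarrow> ln (norm a) + 0"
    using assms(2) by (rule unity_mean_const_add_tendsto)
  moreover have "ln (norm a) + ln (norm (1 - poly [:0, 1 / a:] z * inverse z ^ 0)) = ln (norm (z - a))"
    if "norm z = 1" for z
  proof -
    have "z \<noteq> a" using that a by auto
    have "1 - poly [:0, 1 / a:] z * inverse z ^ 0 = (a - z) / a"
      using \<open>a \<noteq> 0\<close> by (simp add: field_simps)
    then have "norm (1 - poly [:0, 1 / a:] z * inverse z ^ 0) = norm (z - a) / norm a"
      by (simp add: norm_divide norm_minus_commute)
    then show ?thesis using \<open>z \<noteq> a\<close> \<open>a \<noteq> 0\<close> by (simp add: ln_div)
  qed
  ultimately have "(\<lambda>K. unity_mean (N * K) (\<lambda>z. ln (norm (z - a)))) \<longlonglongrightarrow> ln (norm a)"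
    by (simp cong: unity_mean_cong)
  then show ?thesis using a by (simp add: max_def)
qed

lemma unity_mean_log_prod_linear:
  fixes A :: "complex multiset"
  assumes "\<And>a. a \<in># A \<Longrightarrow> norm a \<noteq> 1" "N > 0"
  shows "(\<lambda>K. unity_mean (N * K) (\<lambda>z. ln (norm (\<Prod>a\<in>#A. z - a))))
           \<longlonglongrightarrow> ln (\<Prod>a\<in>#A. max 1 (norm a))"
  using assms(1)
proof (induction A)
  case empty
  then show ?case by (simp add: unity_mean_def)
next
  case (add a A)
  have pos: "(\<Prod>a\<in>#A. max 1 (norm a)) > 0" by (induction A) (auto simp: less_max_iff_disj)
  have nz: "(\<Prod>a\<in>#A. z - a) \<noteq> 0" "z - a \<noteq> 0" if "norm z = 1" for z
    using add.prems that by (auto simp: prod_mset_zero_iff)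
  have "(\<lambda>K. unity_mean (N * K) (\<lambda>z. ln (norm (z - a))) + unity_mean (N * K) (\<lambda>z. ln (norm (\<Prod>a\<in>#A. z - a))))
    \<longlonglongrightarrow> ln (max 1 (norm a)) + ln (\<Prod>a\<in>#A. max 1 (norm a))"
    using add by (intro tendsto_add unity_mean_log_linear assms(2)) auto
  moreover have "ln (max 1 (norm a)) + ln (\<Prod>a\<in>#A. max 1 (norm a)) = ln (\<Prod>a\<in>#add_mset a A. max 1 (norm a))"
    using ln_mult_pos[of "max 1 (norm a)" "\<Prod>a\<in>#A. max 1 (norm a)"] pos by simp
  moreover have "unity_mean (N * K) (\<lambda>z. ln (norm (z - a))) + unity_mean (N * K) (\<lambda>z. ln (norm (\<Prod>a\<in>#A. z - a)))
     = unity_mean (N * K) (\<lambda>z. ln (norm (\<Prod>a\<in>#add_mset a A. z - a)))" for K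
    unfolding unity_mean_add[symmetric]
    by (rule unity_mean_cong) (use nz in \<open>simp add: norm_mult ln_mult\<close>)
  ultimately show ?case by simp
qed

lemma norm_prod_mset_complex: "norm (\<Prod>a\<in>#A. f a :: complex) = (\<Prod>a\<in>#A. norm (f a))"
  by (induction A) (simp_all add: norm_mult)

text \<open>
  Compute the limit of the mean of \<open>ln (norm (G z - w * z ^ \<rho>))\<close> in two ways. Since all constant
  terms vanish, it is \<open>ln w\<close>. By the factorisation and the discrete Jensen formula it is the
  logarithm of the absolute value of the leading coefficient times that of the product of the
  roots outside the unit circle.
  The product of all roots is known from the constant coefficient, which leaves the product of
  the roots inside. The lower bound on \<open>w\<close> keeps the roots off the unit circle.
\<close>

lemma small_roots_product:
  fixes G :: "complex poly" and A :: "complex multiset"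
  assumes \<rho>: "0 < \<rho>" "\<rho> < degree G"
    and zero: "\<And>n. n \<ge> 1 \<Longrightarrow> coeff (G ^ n) (\<rho> * n) = 0"
    and w: "w > (\<Sum>i\<le>degree G. norm (coeff G i))"
    and A: "G - monom (of_real w) \<rho> = Polynomial.smult (lead_coeff G) (\<Prod>a\<in>#A. [:- a, 1:])"
  shows "w * (\<Prod>a\<in>#A. min 1 (norm a)) = norm (coeff G 0)"
proof -
  define N where "N = degree G"
  have N: "N > 0" using \<rho> by (simp add: N_def)
  have lc: "lead_coeff G \<noteq> 0" using \<rho> by auto
  define C where "C = (\<Sum>i\<le>N. norm (coeff G i))"
  have C0: "C \<ge> 0" unfolding C_def by (intro sum_nonneg) simp
  have w0: "w > 0" using w C0 by (simp add: C_def N_def)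
  have bound: "norm (poly G z) \<le> C" if "norm z = 1" for z
  proof -
    have "norm (poly G z) \<le> (\<Sum>i\<le>N. norm (coeff G i * z ^ i))"
      unfolding poly_altdef N_def by (rule norm_sum)
    then show ?thesis using that by (simp add: C_def norm_mult norm_power)
  qed
  have eval: "poly G z - w * z ^ \<rho> = lead_coeff G * (\<Prod>a\<in>#A. z - a)" for z :: complex
  proof -
    have "poly (\<Prod>a\<in>#A. [:- a, 1:]) z = (\<Prod>a\<in>#A. z - a)" by (induction A) (simp_all add: algebra_simps)
    then show ?thesis using arg_cong[OF A, of "\<lambda>p. poly p z"] by (simp add: poly_monom)
  qed
  have nz: "poly G z - w * z ^ \<rho> \<noteq> 0" if "norm z = 1" for z :: complex
  proof
    assume "poly G z - w * z ^ \<rho> = 0"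
    then have "norm (poly G z) = norm (w * z ^ \<rho>)" by simp
    then show False using bound[OF that] that w w0 by (simp add: norm_mult norm_power C_def N_def)
  qed
  have off: "norm a \<noteq> 1" if "a \<in># A" for a
  proof
    assume "norm a = 1"
    from nz[OF this] show False using that by (auto simp: eval prod_mset_zero_iff)
  qed
  have lim1: "(\<lambda>K. unity_mean (N * K) (\<lambda>z. ln (norm (poly G z - w * z ^ \<rho>)))) \<longlonglongrightarrow>
      ln (norm (lead_coeff G)) + ln (\<Prod>a\<in>#A. max 1 (norm a))"
  proof -
    have "ln (norm (lead_coeff G)) + ln (norm (\<Prod>a\<in>#A. z - a)) = ln (norm (poly G z - w * z ^ \<rho>))"
      if "norm z = 1" for z :: complex
      using nz[OF that] unfolding eval by (simp add: norm_mult ln_mult)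
    then have "unity_mean (N * K) (\<lambda>z. ln (norm (poly G z - w * z ^ \<rho>))) =
        unity_mean (N * K) (\<lambda>z. ln (norm (lead_coeff G)) + ln (norm (\<Prod>a\<in>#A. z - a)))" for K
      by (intro unity_mean_cong) simp
    then show ?thesis
      using unity_mean_const_add_tendsto[OF unity_mean_log_prod_linear[OF off N] N] by simp
  qed
  have lim2: "(\<lambda>K. unity_mean (N * K) (\<lambda>z. ln (norm (poly G z - w * z ^ \<rho>)))) \<longlonglongrightarrow> ln w + 0"
  proof -
    define H where "H = Polynomial.smult (1 / w) G"
    have *: "(\<lambda>K. unity_mean (N * K) (\<lambda>z. ln (norm (1 - poly H z * inverse z ^ \<rho>)))) \<longlonglongrightarrow> 0"
    proof (rule unity_mean_log_tendsto_0)
      show "coeff (H ^ n) (\<rho> * n) = 0" if "n \<ge> 1" for n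
        using zero[OF that] by (simp add: H_def smult_power)
      show "norm (poly H z) \<le> C / w" if "norm z = 1" for z
        using bound[OF that] w0 by (simp add: H_def norm_mult norm_divide divide_right_mono)
      show "C / w < 1" using w w0 by (simp add: C_def N_def)
    qed (use \<rho> w0 in \<open>auto simp: H_def N_def\<close>)
    have "ln w + ln (norm (1 - poly H z * inverse z ^ \<rho>)) = ln (norm (poly G z - w * z ^ \<rho>))"
      if "norm z = 1" for z :: complex
    proof -
      have "z \<noteq> 0" using that by auto
      then have "poly G z - w * z ^ \<rho> = - (w * z ^ \<rho> * (1 - poly H z * inverse z ^ \<rho>))"
        using w0 by (simp add: H_def field_simps)
      then have eq: "norm (poly G z - w * z ^ \<rho>) = w * norm (1 - poly H z * inverse z ^ \<rho>)"
        using that w0 by (simp add: norm_mult norm_power)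
      then have "norm (1 - poly H z * inverse z ^ \<rho>) > 0" using nz[OF that] w0 by auto
      then show ?thesis using w0 by (simp add: eq ln_mult_pos)
    qed
    then have "unity_mean (N * K) (\<lambda>z. ln (norm (poly G z - w * z ^ \<rho>))) =
        unity_mean (N * K) (\<lambda>z. ln w + ln (norm (1 - poly H z * inverse z ^ \<rho>)))" for K
      by (intro unity_mean_cong) simp
    then show ?thesis using unity_mean_const_add_tendsto[OF * N] by simp
  qed
  have pos: "(\<Prod>a\<in>#A. max 1 (norm a)) > 0" by (induction A) (auto simp: less_max_iff_disj)
  have "ln w = ln (norm (lead_coeff G)) + ln (\<Prod>a\<in>#A. max 1 (norm a))"
    using LIMSEQ_unique[OF lim2 lim1] by simp
  also have "\<dots> = ln (norm (lead_coeff G) * (\<Prod>a\<in>#A. max 1 (norm a)))"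
    using pos lc by (intro ln_mult_pos[symmetric]) auto
  finally have w_eq: "w = norm (lead_coeff G) * (\<Prod>a\<in>#A. max 1 (norm a))"
    using w0 pos lc by (simp add: zero_less_mult_iff)
  have "coeff G 0 = lead_coeff G * (\<Prod>a\<in>#A. - a)"
    using eval[of 0] \<rho> by (simp add: poly_0_coeff_0 power_0_left)
  then have "norm (coeff G 0) = norm (lead_coeff G) * (\<Prod>a\<in>#A. norm a)"
    by (simp add: norm_mult norm_prod_mset_complex)
  also have "(\<Prod>a\<in>#A. norm a) = (\<Prod>a\<in>#A. max 1 (norm a)) * (\<Prod>a\<in>#A. min 1 (norm a))"
  proof -
    have "norm a = max 1 (norm a) * min 1 (norm a)" for a :: complex by (simp add: max_def min_def)
    then have "(\<Prod>a\<in>#A. norm a) = (\<Prod>a\<in>#A. max 1 (norm a) * min 1 (norm a))" by simp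
    then show ?thesis by (simp only: prod_mset.distrib)
  qed
  finally show ?thesis using w_eq by (simp add: mult_ac)
qed

text \<open>
  Choose for \<open>w\<close> a large natural number and let \<open>y\<close> be the product of the roots inside the unit circle,
  times a power of the leading coefficient \<open>g\<close> that makes it integral. By the previous lemma
  \<open>w * norm y\<close> does not depend on \<open>w\<close>, so \<open>w\<^sup>2\<close> divides the fixed nonzero algebraic integer
  \<open>\<kappa> = (w * norm y)\<^sup>2\<close>; this is impossible for large \<open>w\<close>.
\<close>

lemma not_all_constant_terms_zero_integral:
  fixes G :: "complex poly"
  assumes int: "\<And>i. algebraic_int (coeff G i)"
    and G0: "coeff G 0 \<noteq> 0" and \<rho>: "0 < \<rho>" "\<rho> < degree G"
  shows "\<exists>n\<ge>1. coeff (G ^ n) (\<rho> * n) \<noteq> 0"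
proof (rule ccontr)
  assume "\<not> (\<exists>n\<ge>1. coeff (G ^ n) (\<rho> * n) \<noteq> 0)"
  then have zero: "\<And>n. n \<ge> 1 \<Longrightarrow> coeff (G ^ n) (\<rho> * n) = 0" by blast
  define N where "N = degree G"
  define g where "g = lead_coeff G"
  define \<kappa> where "\<kappa> = (g ^ N * coeff G 0) * cnj (g ^ N * coeff G 0)"
  have g: "g \<noteq> 0" "algebraic_int g" using \<rho> int by (auto simp: g_def)
  have "algebraic_int \<kappa>"
    unfolding \<kappa>_def using g int by (intro algebraic_int_mult algebraic_int_cnj algebraic_int_power)
  moreover have "\<kappa> \<noteq> 0" using g G0 by (simp add: \<kappa>_def)
  ultimately obtain k :: int where k: "k \<noteq> 0" "algebraic_int (of_int k / \<kappa>)"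
    using algebraic_int_divides_integer by blast
  obtain w :: nat where w: "real w > max (\<Sum>i\<le>degree G. norm (coeff G i)) (of_int \<bar>k\<bar>)"
    using reals_Archimedean2 by blast
  define q where "q = G - monom (of_real (real w)) \<rho>"
  have cq: "coeff q i = (if i = \<rho> then coeff G i - of_nat w else coeff G i)" for i
    by (simp add: q_def)
  have deg: "degree q = N"
    using \<rho> g by (intro antisym degree_le le_degree) (auto simp: cq N_def g_def coeff_eq_0)
  have lcq: "lead_coeff q = g" using \<rho> deg by (simp add: cq g_def N_def)
  have intq: "algebraic_int (coeff q i)" for i
    using int by (auto simp: cq intro: algebraic_int_diff algebraic_int_of_nat)
  have "q \<noteq> 0" using deg \<rho> by (auto simp: N_def)
  then obtain A where A: "size A = N" "q = Polynomial.smult g (\<Prod>a\<in>#A. [:- a, 1:])"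
    using alg_closed_imp_factorization[of q] deg lcq by auto
  have root: "algebraic_int (g * a)" if "a \<in># A" for a
  proof -
    have "poly q a = 0"
      using that by (subst A(2)) (auto simp: poly_prod_mset prod_mset_zero_iff image_iff intro!: bexI[of _ a])
    then show ?thesis
      using algebraic_int_lead_coeff_mult_root[of q a] intq deg \<rho> lcq by (auto simp: N_def)
  qed
  have small: "real w * (\<Prod>a\<in>#A. min 1 (norm a)) = norm (coeff G 0)"
    using A(2) w by (intro small_roots_product[OF \<rho> zero]) (auto simp: q_def g_def)
  \<comment> \<open>One factor \<open>g\<close> for every root, so that the power of \<open>g\<close> in \<open>norm y\<close> is \<open>N\<close> whatever the number of small roots.\<close>
  define y where "y = (\<Prod>a\<in>#A. if norm a < 1 then g * a else g)"
  have "algebraic_int y"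
    unfolding y_def using root g by (intro algebraic_int_prod_mset) auto
  have "norm y = (\<Prod>a\<in>#A. norm g * min 1 (norm a))"
    unfolding y_def norm_prod_mset_complex by (intro arg_cong[of _ _ prod_mset] image_mset_cong) (auto simp: norm_mult)
  also have "\<dots> = norm g ^ N * (\<Prod>a\<in>#A. min 1 (norm a))"
    unfolding A(1)[symmetric] by (induction A) (simp_all add: mult_ac)
  finally have "real w * norm y = norm (g ^ N * coeff G 0)"
    using small by (simp add: norm_mult norm_power mult_ac)
  then have "(real w * norm y)\<^sup>2 = (norm (g ^ N * coeff G 0))\<^sup>2" by simp
  then have "complex_of_real ((real w * norm y)\<^sup>2) = of_real ((norm (g ^ N * coeff G 0))\<^sup>2)" by simp
  then have \<kappa>: "\<kappa> = of_nat w ^ 2 * (y * cnj y)"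
    unfolding \<kappa>_def complex_norm_square[symmetric] by (simp add: power_mult_distrib)
  have "algebraic_int ((of_int k / \<kappa>) * (y * cnj y))"
    using k \<open>algebraic_int y\<close> by (intro algebraic_int_mult algebraic_int_cnj)
  also have "(of_int k / \<kappa>) * (y * cnj y) = of_int k / of_int (int w ^ 2)"
    using \<open>\<kappa> \<noteq> 0\<close> \<kappa> by (auto simp: field_simps)
  finally have "int w ^ 2 dvd k"
    using \<open>\<kappa> \<noteq> 0\<close> \<kappa> by (intro algebraic_int_quotient_imp_dvd[where 'a = complex]) auto
  then have "int w dvd k" by (metis dvd_mult_left power2_eq_square)
  then have "int w \<le> \<bar>k\<bar>" using dvd_imp_le_int[OF k(1)] by fastforce
  then show False using w by linarith
qed

lemma algebraic_int_coeff_power: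
  fixes p :: "'c::field_char_0 poly"
  assumes "\<And>i. algebraic_int (coeff p i)"
  shows "algebraic_int (coeff (p ^ n) i)"
proof (induction n arbitrary: i)
  case 0
  show ?case using algebraic_int_of_nat[of 1] by (auto simp: coeff_1)
next
  case (Suc n)
  then show ?case
    using assms by (auto simp: coeff_mult intro!: algebraic_int_sum algebraic_int_mult)
qed

text \<open>
  The Laurent polynomial \<open>g z / z ^ r\<close> has smallest exponent \<open>- r\<close> and largest exponent
  \<open>degree g - r\<close>. If one of these is \<open>0\<close>, the constant terms of its powers are powers of an
  extreme coefficient; otherwise the integral case applies after clearing denominators. The factor
  \<open>B\<close> passes from \<open>g\<close> to \<open>g ^ B\<close>, whose exponents are \<open>B\<close> times as spread out.
\<close>

theorem not_all_constant_terms_zero: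
  fixes g :: "complex poly"
  assumes alg: "\<And>i. algebraic (coeff g i)" and g0: "coeff g 0 \<noteq> 0" and r: "r \<le> degree g" and B: "B > 0"
  shows "\<exists>n\<ge>1. coeff (g ^ (B * n)) (r * (B * n)) \<noteq> 0"
proof -
  have "g \<noteq> 0" using g0 by auto
  consider "r = 0" | "r = degree g" | "0 < r" "r < degree g" using r by linarith
  then show ?thesis
  proof cases
    case 1
    then show ?thesis using g0 by (intro exI[of _ 1]) (simp add: coeff_0_power)
  next
    case 2
    have "coeff (g ^ B) (r * B) = lead_coeff (g ^ B)"
      using 2 \<open>g \<noteq> 0\<close> by (simp add: degree_power_eq mult.commute)
    then show ?thesis using \<open>g \<noteq> 0\<close> by (intro exI[of _ 1]) simp
  next
    case 3
    obtain D :: nat where D: "D > 0"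
      "\<And>x. x \<in> coeff g ` {..degree g} \<Longrightarrow> algebraic_int (of_nat D * x)"
      using algebraic_finite_common_denominator[of "coeff g ` {..degree g}"] alg
      by (metis finite_atMost finite_imageI imageE)
    define h where "h = Polynomial.smult (of_nat D) g"
    have "algebraic_int (coeff h i)" for i
      using D(2)[of "coeff g i"] by (cases "i \<le> degree g") (auto simp: h_def coeff_eq_0)
    then have "algebraic_int (coeff (h ^ B) i)" for i by (rule algebraic_int_coeff_power)
    moreover have "coeff (h ^ B) 0 \<noteq> 0" using D(1) g0 by (simp add: h_def coeff_0_power)
    moreover have "degree (h ^ B) = B * degree g"
      using D(1) \<open>g \<noteq> 0\<close> by (simp add: h_def degree_power_eq)
    ultimately obtain n where "n \<ge> 1" "coeff ((h ^ B) ^ n) (r * B * n) \<noteq> 0"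
      using not_all_constant_terms_zero_integral[of "h ^ B" "r * B"] 3 B by (auto simp: mult.commute)
    then show ?thesis by (auto simp: h_def smult_power mult.assoc power_mult)
  qed
qed

section \<open>Constant terms of Laurent polynomials\<close>

interpretation laurent_series: monomial_substitution fls_const "fls_X_intpow :: int \<Rightarrow> complex fls"
  by unfold_locales (simp_all add: fls_plus_const fls_const_mult_const fls_X_intpow_times_fls_X_intpow)

lemma fls_nth_laurent_series:
  "fls_nth (monomial_subst fls_const fls_X_intpow f) k = Poly_Mapping.lookup f k" for f :: laurent_poly
proof -
  have "fls_nth (monomial_subst fls_const fls_X_intpow f) k =
      (\<Sum>i\<in>Poly_Mapping.keys f. if i = k then Poly_Mapping.lookup f i else 0)"
    unfolding monomial_subst_def fls_nth_sum by (intro sum.cong) auto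
  then show ?thesis by (simp add: in_keys_iff)
qed

text \<open>
  \<open>R\<close> is \<open>g\<close> divided by the \<open>r\<close>-th power of the variable; this is made precise in the ring of formal
  Laurent series, where that power is invertible.
\<close>

lemma CT_power_eq_coeff:
  assumes g: "\<And>i. Poly_Mapping.lookup R (int i - int r) = coeff g i"
    and low: "\<And>k. k \<in> Poly_Mapping.keys R \<Longrightarrow> k \<ge> - int r"
  shows "CT (R ^ m) = coeff (g ^ m) (r * m)"
proof -
  let ?L = "monomial_subst fls_const fls_X_intpow :: laurent_poly \<Rightarrow> complex fls"
  have "?L R = fls_shift (int r) (fps_to_fls (fps_of_poly g))"
  proof (rule fls_eqI)
    fix k
    show "fls_nth (?L R) k = fls_nth (fls_shift (int r) (fps_to_fls (fps_of_poly g))) k"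
    proof (cases "k \<ge> - int r")
      case True
      then show ?thesis
        using g[of "nat (k + int r)"] by (simp add: fls_nth_laurent_series)
    next
      case False
      then show ?thesis
        using low[of k] by (auto simp: fls_nth_laurent_series in_keys_iff)
    qed
  qed
  then have "?L (R ^ m) = fls_shift (int r) (fps_to_fls (fps_of_poly g)) ^ m"
    by (simp add: laurent_series.subst_power)
  also have "\<dots> = fls_shift (int (r * m)) (fps_to_fls (fps_of_poly (g ^ m)))"
    by (induction m) (simp_all add: fls_times_both_shifted_simp fls_times_fps_to_fls fps_of_poly_mult)
  finally have "fls_nth (?L (R ^ m)) 0 = fls_nth (fls_shift (int (r * m)) (fps_to_fls (fps_of_poly (g ^ m)))) 0"
    by (rule arg_cong)
  then show ?thesis unfolding fls_nth_laurent_series by (simp add: CT_def del: of_nat_mult)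
qed

text \<open>
  The theorem of Duistermaat and van der Kallen in one variable, for algebraic coefficients, from the
  constant terms of only those powers of \<open>R\<close> whose exponent is divisible by \<open>B\<close>.
\<close>

lemma constant_terms_zero_imp_one_sided:
  fixes R :: laurent_poly
  assumes alg: "\<And>k. algebraic (Poly_Mapping.lookup R k)"
    and B: "B > 0" and zero: "\<And>n. n \<ge> 1 \<Longrightarrow> CT (R ^ (B * n)) = 0"
  shows "(\<forall>k\<in>Poly_Mapping.keys R. k > 0) \<or> (\<forall>k\<in>Poly_Mapping.keys R. k < 0)"
proof (rule ccontr)
  let ?K = "Poly_Mapping.keys R"
  assume "\<not> ?thesis"
  then obtain k1 k2 where k: "k1 \<in> ?K" "k1 \<le> 0" "k2 \<in> ?K" "k2 \<ge> 0" by (auto simp: not_less)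
  define \<mu> where "\<mu> = Min ?K"
  have "?K \<noteq> {}" using k(1) by blast
  then have \<mu>: "\<mu> \<in> ?K" "\<And>k. k \<in> ?K \<Longrightarrow> \<mu> \<le> k"
    unfolding \<mu>_def by (rule Min_in[OF finite_keys], simp)
  define r where "r = nat (- \<mu>)"
  have r: "int r = - \<mu>" using \<mu>(2)[OF k(1)] k(2) by (simp add: r_def)
  define N where "N = nat (Max ?K + int r)"
  have N: "nat (k + int r) \<le> N" if "k \<in> ?K" for k
    using that unfolding N_def by (intro nat_mono add_right_mono Max_ge) auto
  define g where "g = (\<Sum>i\<le>N. monom (Poly_Mapping.lookup R (int i - int r)) i)"
  have coeff: "Poly_Mapping.lookup R (int i - int r) = coeff g i" for i
  proof (cases "i \<le> N")
    case False
    then have "int i - int r \<notin> ?K" using N[of "int i - int r"] by auto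
    then show ?thesis using False by (simp add: g_def coeff_sum in_keys_iff)
  qed (simp add: g_def coeff_sum)
  have "coeff g 0 \<noteq> 0"
    using \<mu>(1) coeff[of 0] r by (simp add: in_keys_iff)
  moreover have "r \<le> degree g"
  proof -
    have "coeff g (r + nat k2) \<noteq> 0"
      using k(3,4) coeff[of "r + nat k2"] by (simp add: in_keys_iff)
    then show ?thesis using le_degree by fastforce
  qed
  moreover have "algebraic (coeff g i)" for i using alg coeff by metis
  ultimately obtain n where "n \<ge> 1" "coeff (g ^ (B * n)) (r * (B * n)) \<noteq> 0"
    using not_all_constant_terms_zero B by blast
  moreover have "CT (R ^ (B * n)) = coeff (g ^ (B * n)) (r * (B * n))"
    using coeff \<mu>(2) r by (intro CT_power_eq_coeff) auto
  ultimately show False using zero by simp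
qed

section \<open>The lowest face\<close>

interpretation weight_grading: monomial_substitution
    "Poly_Mapping.single 0 :: complex \<Rightarrow> laurent_poly" "\<lambda>\<alpha>. Poly_Mapping.single (weight \<alpha>) 1"
  by unfold_locales (simp_all add: single_add mult_single weight_def single_one algebra_simps)

lemma CT_weight_substitution:
  "CT (monomial_subst (Poly_Mapping.single 0) (\<lambda>\<alpha>. Poly_Mapping.single (weight \<alpha>) 1) Q) =
     (\<Sum>\<alpha>\<in>Poly_Mapping.keys Q. Poly_Mapping.lookup Q \<alpha> when weight \<alpha> = 0)"
  by (simp add: CT_def monomial_subst_def mult_single lookup_sum lookup_single)

text \<open>
  Let \<open>a / B\<close> be the quotient \<open>lam / (c + d)\<close> in lowest terms. On the diagonal \<open>l (k, k) = (c + d) * k\<close>, so the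
  face of \<open>P ^ (B * n)\<close> can meet the diagonal only in \<open>(k1, k1)\<close> with \<open>k1 = a * n\<close>, and the diagonal
  monomials of its \<open>j\<close>-th power start no earlier than \<open>j * k1\<close>.
\<close>

theorem lemma7:
  fixes M :: "'a measure" and X Y :: "'a \<Rightarrow> real"
    and P :: poly_ZW and S F :: "(nat \<times> nat) set" and R :: laurent_poly
    and c d lam :: int and l :: "nat \<times> nat \<Rightarrow> int" and B :: nat
  assumes "prob_space M"
    and "distributed M lborel X std_normal_density"
    and "distributed M lborel Y std_normal_density"
    and "prob_space.indep_var M borel X borel Y"
    and "\<And>\<alpha>. algebraic (Poly_Mapping.lookup P \<alpha>)" and "P \<noteq> 0"
    and "S = Poly_Mapping.keys P"
    and "c + d > 0"
    and "\<And>a b. l (a, b) = c * int a + d * int b"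
    and "lam = Min (l ` S)"
    and "F = {\<alpha> \<in> S. l \<alpha> = lam}"
    and "R = (\<Sum>\<alpha>\<in>F. Poly_Mapping.single (weight \<alpha>) (Poly_Mapping.lookup P \<alpha>))"
    and "\<And>m::nat. m \<ge> 1 \<Longrightarrow> gauss_expectation M X Y (P ^ m) = 0"
    and "(of_int lam / of_int (c + d) :: rat) \<ge> 0"
    and "B = nat (snd (quotient_of (of_int lam / of_int (c + d))))"
  shows "(\<forall>n::nat. n \<ge> 1 \<longrightarrow> CT (R ^ (B * n)) = 0)
       \<and> ((\<forall>k\<in>Poly_Mapping.keys R. k > 0) \<or> (\<forall>k\<in>Poly_Mapping.keys R. k < 0))
       \<and> ((\<forall>\<alpha>\<in>F. weight \<alpha> > 0) \<or> (\<forall>\<alpha>\<in>F. weight \<alpha> < 0))"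
proof -
  note alg = assms(5) and S = assms(7) and cd = assms(8) and l = assms(9)
    and F = assms(11) and R = assms(12)
  have lam_le: "lam \<le> l \<alpha>" if "\<alpha> \<in> S" for \<alpha>
    using that assms(10) S by simp
  obtain a b where ab: "quotient_of (of_int lam / of_int (c + d)) = (a, b)" by fastforce
  have b: "b > 0" using ab by (rule quotient_of_denom_pos)
  have B: "B > 0" "int B = b" using assms(15) ab b by auto
  have frac: "(of_int lam / of_int (c + d) :: rat) = of_int a / of_int b"
    using ab by (rule quotient_of_div)
  have a: "a \<ge> 0" using assms(14) b unfolding frac by (simp add: zero_le_divide_iff)
  have "(of_int (lam * b) :: rat) = of_int (a * (c + d))"
    using frac b cd by (simp add: frac_eq_eq del: of_int_add)
  then have lamB: "lam * int B = a * (c + d)" unfolding B(2) by (simp only: of_int_eq_iff)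
  define PF where "PF = (\<Sum>\<alpha>\<in>F. Poly_Mapping.single \<alpha> (Poly_Mapping.lookup P \<alpha>))"
  have finF: "finite F" using F S by simp
  have lookup_PF: "Poly_Mapping.lookup PF \<alpha> = (Poly_Mapping.lookup P \<alpha> when \<alpha> \<in> F)" for \<alpha>
    using finF by (simp add: PF_def lookup_sum lookup_single when_def)
  have keys_PF: "Poly_Mapping.keys PF = F"
    using F S by (auto simp: in_keys_iff lookup_PF when_def)
  have face: "(\<forall>k\<in>Poly_Mapping.keys (PF ^ m). l k = int m * lam) \<and>
         (\<forall>k\<in>Poly_Mapping.keys (P ^ m - PF ^ m). l k > int m * lam)" for m
  proof (rule face_power)
    show "l 0 = 0" by (simp add: zero_prod_def l)
    show "l (\<alpha> + \<beta>) = l \<alpha> + l \<beta>" for \<alpha> \<beta>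
      by (cases \<alpha>; cases \<beta>) (simp add: l algebra_simps)
    show "l \<alpha> = lam" if "\<alpha> \<in> Poly_Mapping.keys PF" for \<alpha>
      using that F by (simp add: keys_PF)
    show "l \<alpha> > lam" if "\<alpha> \<in> Poly_Mapping.keys (P - PF)" for \<alpha>
    proof -
      have "\<alpha> \<in> S" "\<alpha> \<notin> F"
        using that S by (auto simp: in_keys_iff lookup_minus lookup_PF when_def split: if_splits)
      then show ?thesis using lam_le[of \<alpha>] F by fastforce
    qed
  qed
  have lookup_face: "Poly_Mapping.lookup (P ^ m) \<alpha> = Poly_Mapping.lookup (PF ^ m) \<alpha>"
    if "l \<alpha> \<le> int m * lam" for m \<alpha>
  proof -
    have "\<alpha> \<notin> Poly_Mapping.keys (P ^ m - PF ^ m)" using face[of m] that by force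
    then show ?thesis by (simp add: in_keys_iff lookup_minus)
  qed
  have lookup_below: "Poly_Mapping.lookup (P ^ m) \<alpha> = 0" if "l \<alpha> < int m * lam" for m \<alpha>
  proof -
    have "\<alpha> \<notin> Poly_Mapping.keys (PF ^ m)" using face[of m] that by force
    then show ?thesis using lookup_face that by (simp add: in_keys_iff)
  qed
  have R_subst: "R = monomial_subst (Poly_Mapping.single 0) (\<lambda>\<alpha>. Poly_Mapping.single (weight \<alpha>) 1) PF"
    unfolding monomial_subst_def keys_PF R by (intro sum.cong) (simp_all add: mult_single lookup_PF)
  have CT0: "CT (R ^ (B * n)) = 0" if n: "n \<ge> 1" for n
  proof -
    define k1 where "k1 = nat a * n"
    \<comment> \<open>Measured from the level of the face of \<open>P ^ (B * n * j)\<close>, the diagonal is crossed at \<open>j * k1\<close>.\<close>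
    have k1: "l (k, k) = int (B * n * j) * lam + (c + d) * (int k - int (j * k1))" for j k
    proof -
      have "int (B * n * j) * lam = int n * int j * (lam * int B)" by simp
      also have "\<dots> = (c + d) * int (j * k1)" unfolding lamB using a by (simp add: k1_def)
      finally show ?thesis by (simp add: l algebra_simps)
    qed
    have "CT (R ^ (B * n)) = (\<Sum>\<alpha>\<in>Poly_Mapping.keys (PF ^ (B * n)).
        Poly_Mapping.lookup (PF ^ (B * n)) \<alpha> when weight \<alpha> = 0)"
      unfolding R_subst weight_grading.subst_power[symmetric] by (rule CT_weight_substitution)
    also have "\<dots> = (\<Sum>\<alpha>\<in>Poly_Mapping.keys (PF ^ (B * n)).
        if \<alpha> = (k1, k1) then Poly_Mapping.lookup (PF ^ (B * n)) \<alpha> else 0)"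
    proof (rule sum.cong)
      fix \<alpha> assume "\<alpha> \<in> Poly_Mapping.keys (PF ^ (B * n))"
      then have l\<alpha>: "l \<alpha> = int (B * n) * lam" using face by blast
      have diag: "\<alpha> = (k1, k1)" if "weight \<alpha> = 0"
      proof -
        from that obtain k where \<alpha>: "\<alpha> = (k, k)" by (cases \<alpha>) (simp add: weight_def)
        then have "(c + d) * (int k - int k1) = 0" using k1[of k 1] l\<alpha> by simp
        then show ?thesis using cd \<alpha> by simp
      qed
      have "weight (k1, k1) = 0" by (simp add: weight_def)
      then show "(Poly_Mapping.lookup (PF ^ (B * n)) \<alpha> when weight \<alpha> = 0) =
          (if \<alpha> = (k1, k1) then Poly_Mapping.lookup (PF ^ (B * n)) \<alpha> else 0)"
        using diag by (cases "\<alpha> = (k1, k1)") (simp_all add: when_def, blast)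
    qed simp
    also have "\<dots> = Poly_Mapping.lookup (PF ^ (B * n)) (k1, k1)"
      by (simp add: in_keys_iff)
    also have "\<dots> = Poly_Mapping.lookup (P ^ (B * n)) (k1, k1)"
      using k1[of k1 1] by (intro lookup_face[symmetric]) simp
    also have "\<dots> = 0"
    proof (rule lowest_diagonal_coeff_eq_0[OF alg])
      fix j k assume "k < j * k1"
      then have "(c + d) * (int k - int (j * k1)) < 0"
        using cd by (intro mult_pos_neg) (simp_all del: of_nat_mult)
      then show "Poly_Mapping.lookup (P ^ (B * n * j)) (k, k) = 0"
        using k1[of k j] by (intro lookup_below) linarith
    next
      fix j :: nat assume "j \<ge> 1"
      then have "B * n * j \<ge> 1" using n B by simp
      then have "gauss_expectation M X Y (P ^ (B * n * j)) = 0" by (rule assms(13))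
      then show "diagonal_factorial_sum (P ^ (B * n * j)) = 0"
        by (simp add: prob_space.gauss_expectation_eq[OF assms(1-4)] diagonal_factorial_sum_def)
    qed
    finally show ?thesis .
  qed
  \<comment> \<open>On the face the weight determines the exponent pair, so that no coefficients cancel in \<open>R\<close>.\<close>
  have inj: "\<alpha> = \<beta>" if "\<alpha> \<in> F" "\<beta> \<in> F" "weight \<alpha> = weight \<beta>" for \<alpha> \<beta>
  proof -
    obtain i j i' j' where ij: "\<alpha> = (i, j)" "\<beta> = (i', j')" by (cases \<alpha>; cases \<beta>)
    have "c * int i + d * int j = c * int i' + d * int j'" "int i - int j = int i' - int j'"
      using that F by (simp_all add: ij l weight_def)
    then have j: "int j = int i - int i' + int j'" by linarith
    have "(c + d) * (int i - int i') = (c * int i + d * int j) - (c * int i' + d * int j')"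
      unfolding j by (simp add: algebra_simps)
    then have "(c + d) * (int i - int i') = 0"
      using \<open>c * int i + d * int j = c * int i' + d * int j'\<close> by simp
    then have "i = i'" using cd by simp
    then show ?thesis using \<open>int i - int j = int i' - int j'\<close> by (simp add: ij)
  qed
  have lookup_R: "Poly_Mapping.lookup R (weight \<alpha>) = Poly_Mapping.lookup P \<alpha>" if "\<alpha> \<in> F" for \<alpha>
  proof -
    have "Poly_Mapping.lookup R (weight \<alpha>) = (\<Sum>\<beta>\<in>F. if \<beta> = \<alpha> then Poly_Mapping.lookup P \<beta> else 0)"
      unfolding R lookup_sum lookup_single using inj that by (intro sum.cong) (auto simp: when_def)
    then show ?thesis using finF that by simp
  qed
  have lookup_R': "Poly_Mapping.lookup R k = 0" if "k \<notin> weight ` F" for k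
    unfolding R lookup_sum lookup_single using that by (intro sum.neutral) (auto simp: when_def)
  have "algebraic (Poly_Mapping.lookup R k)" for k
    using lookup_R lookup_R' alg by (cases "k \<in> weight ` F") auto
  then have sides: "(\<forall>k\<in>Poly_Mapping.keys R. k > 0) \<or> (\<forall>k\<in>Poly_Mapping.keys R. k < 0)"
    using B(1) CT0 by (rule constant_terms_zero_imp_one_sided)
  moreover have "weight \<alpha> \<in> Poly_Mapping.keys R" if "\<alpha> \<in> F" for \<alpha>
    using lookup_R[OF that] that F S by (simp add: in_keys_iff)
  ultimately show ?thesis using CT0 by blast
qed

end
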